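(* For $n\ge0$ let $W_n(z)=z^{-\lfloor (n+1)/2\rfloor}\Gamma_{Y_n}(z)$ and $d_n=\lceil (n+1)/2\rceil$. Then for every $n\ge0$ the polynomial $W_n(z)$ (which has degree $d_n$) is real-rooted. Moreover, denoting the roots of $W_k(z)$ by $x_{k,1}<x_{k,2}<\cdots<x_{k,d_k}$ (they are real and distinct), we have: (i) for every $n\ge2$, $W_n$ has one more root than $W_{n-2}$, and $$x_{n,1}<x_{n-2,1}<x_{n,2}<x_{n-2,2}<\cdots<x_{n,d_n-1}<x_{n-2,d_n-1}<x_{n,d_n};$$ (ii) for every $n\ge1$, $W_n$ has one more root than $W_{n-1}$ when $n$ is even and the same number of roots when $n$ is odd, and $$x_{n,1}<x_{n-1,1}<x_{n,2}<x_{n-1,2}<\cdots<x_{n-1,d_n-1}<x_{n,d_n}\quad\text{if $n$ is even},$$ $$x_{n,1}<x_{n-1,1}<x_{n,2}<x_{n-1,2}<\cdots<x_{n,d_n}<x_{n-1,d_n}\quad\text{if $n$ is odd}.$$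
   Context: All embeddings are cellular embeddings in closed orientable surfaces, counted up to combinatorial equivalence (distinct rotation systems counted as distinct). The genus polynomial of a connected graph $G$ is $\Gamma_G(z)=\sum_{i\ge0}g_i(G)z^i$, where $g_i(G)$ is the number of embeddings of $G$ in the orientable surface of genus $i$. The iterated claws $Y_n$: $Y_0$ is the dipole $D_3$ (two vertices joined by three parallel edges) with root $u_0$ one of its vertices; for $n\ge1$, $Y_n$ (with root $u_n$) is obtained from $Y_{n-1}$ by subdividing each of the three edges incident on the root $u_{n-1}$ and joining the three new vertices to a new vertex $u_n$. (The minimum genus of $Y_n$ is $\lfloor (n+1)/2\rfloor$ and its maximum genus is $n+1$, so $W_n$ is a polynomial of degree $d_n$ with nonzero constant term.) *)

theory Defs
  imports
    "HOL-Computational_Algebra.Polynomial"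
    "HOL-Combinatorics.Orbits"
    "Graph_Theory.Bidirected_Digraph"
    Complex_Main
begin

section \<open>Rotation systems and genus polynomials\<close>

text \<open>
  A multigraph is a bidirected digraph \<open>G\<close> with arc reversal \<open>arev\<close> (see the locale
  \<^locale>\<open>bidirected_digraph\<close>): the arcs are the darts (half-edges), and an edge is a pair
  \<open>{a, arev a}\<close>. A rotation system cyclically permutes the darts leaving each vertex.
  It is the identity outside the arcs, so that distinct rotation systems are
  distinct functions.
\<close>

definition rotation_systems :: "('v, 'd) pre_digraph \<Rightarrow> ('d \<Rightarrow> 'd) set" where
  "rotation_systems G =
     {\<rho>. \<rho> permutes arcs G \<and>
         (\<forall>v \<in> verts G. out_arcs G v \<noteq> {} \<longrightarrow> cyclic_on \<rho> (out_arcs G v))}"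

definition faces :: "('v, 'd) pre_digraph \<Rightarrow> ('d \<Rightarrow> 'd) \<Rightarrow> ('d \<Rightarrow> 'd) \<Rightarrow> 'd set set" where
  "faces G arev \<rho> = (\<lambda>a. orbit (\<rho> \<circ> arev) a) ` arcs G"

text \<open>
  The genus is read off Euler's formula \<open>V - E + F = 2 - 2 i\<close>, for finite connected \<open>G\<close>
  with at least one edge (a single vertex has a face that is not an orbit of darts).
\<close>

definition genus_count :: "('v, 'd) pre_digraph \<Rightarrow> ('d \<Rightarrow> 'd) \<Rightarrow> nat \<Rightarrow> nat" where
  "genus_count G arev i =
     card {\<rho> \<in> rotation_systems G.
             int (card (verts G)) - int (card (arcs G) div 2) + int (card (faces G arev \<rho>))
               = 2 - 2 * int i}"

text \<open>For finite \<open>G\<close> only finitely many coefficients are non-zero.\<close>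

definition genus_poly :: "('v, 'd) pre_digraph \<Rightarrow> ('d \<Rightarrow> 'd) \<Rightarrow> real poly" where
  "genus_poly G arev =
     (\<Sum>i | genus_count G arev i \<noteq> 0. monom (of_nat (genus_count G arev i)) i)"


section \<open>Iterated claws\<close>

text \<open>
  The dart \<open>(a, b, j)\<close> runs from \<open>a\<close> to \<open>b\<close>; its reversal is \<open>(b, a, j)\<close>. The label \<open>j\<close>
  tells parallel edges apart. (The graphs below have no loops.)
\<close>

type_synonym 'v dart = "'v \<times> 'v \<times> nat"

definition dart_graph :: "'v set \<Rightarrow> 'v dart set \<Rightarrow> ('v, 'v dart) pre_digraph" where
  "dart_graph V A = \<lparr>verts = V, arcs = A, tail = fst, head = fst \<circ> snd\<rparr>"

definition dart_rev :: "('v, 'v dart) pre_digraph \<Rightarrow> 'v dart \<Rightarrow> 'v dart" where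
  "dart_rev G = (\<lambda>(a, b, j). if (a, b, j) \<in> arcs G then (b, a, j) else (a, b, j))"

definition edge :: "'v \<Rightarrow> 'v \<Rightarrow> nat \<Rightarrow> 'v dart set" where
  "edge a b j = {(a, b, j), (b, a, j)}"

text \<open>
  \<open>claw_extension G u w u'\<close> subdivides each edge incident on \<open>u\<close> -- the edge with dart
  \<open>(u, a, j)\<close> by the new vertex \<open>w j\<close> -- and joins the new vertices to the new vertex \<open>u'\<close>.
  The edges at \<open>u\<close> must have distinct labels; this is preserved at \<open>u'\<close>.
\<close>

definition claw_extension ::
    "('v, 'v dart) pre_digraph \<Rightarrow> 'v \<Rightarrow> (nat \<Rightarrow> 'v) \<Rightarrow> 'v \<Rightarrow> ('v, 'v dart) pre_digraph" where
  "claw_extension G u w u' = dart_graph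
     (verts G \<union> {w j | a j. (u, a, j) \<in> arcs G} \<union> {u'})
     ((arcs G - (out_arcs G u \<union> in_arcs G u)) \<union>
      (\<Union>(_, a, j) \<in> out_arcs G u. edge u (w j) j \<union> edge (w j) a j \<union> edge (w j) u' j))"

text \<open>\<open>Sub n j\<close> subdivides the root edge with label \<open>j\<close> in the step from \<open>n - 1\<close> to \<open>n\<close>.\<close>

datatype claw_vert = Base | Root nat | Sub nat nat

primrec iterated_claw :: "nat \<Rightarrow> (claw_vert, claw_vert dart) pre_digraph" where
  "iterated_claw 0 = dart_graph {Base, Root 0} (\<Union>j \<in> {0, 1, 2}. edge Base (Root 0) j)"
| "iterated_claw (Suc n) =
     claw_extension (iterated_claw n) (Root n) (Sub (Suc n)) (Root (Suc n))"

definition claw_genus_poly :: "nat \<Rightarrow> real poly" where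
  "claw_genus_poly n = genus_poly (iterated_claw n) (dart_rev (iterated_claw n))"


section \<open>The normalised polynomials and their roots\<close>

definition claw_W :: "nat \<Rightarrow> real poly" where
  "claw_W n = claw_genus_poly n div monom 1 ((n + 1) div 2)"

definition claw_deg :: "nat \<Rightarrow> nat" where
  "claw_deg n = nat \<lceil>(real n + 1) / 2\<rceil>"

definition real_rooted :: "real poly \<Rightarrow> bool" where
  "real_rooted p \<longleftrightarrow>
     p \<noteq> 0 \<and> (\<forall>z :: complex. poly (map_poly complex_of_real p) z = 0 \<longrightarrow> z \<in> \<real>)"

definition real_roots :: "real poly \<Rightarrow> real set" where
  "real_roots p = {t. poly p t = 0}"

text \<open>\<open>claw_root k i\<close> is the \<open>i\<close>-th smallest root of \<open>claw_W k\<close>, for \<open>1 \<le> i \<le> card (real_roots (claw_W k))\<close>.\<close>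

definition claw_root :: "nat \<Rightarrow> nat \<Rightarrow> real" where
  "claw_root k i = sorted_list_of_set (real_roots (claw_W k)) ! (i - 1)"

end

theory Submission
  imports Defs
begin

text \<open>
  Classify a rotation system of a graph with a trivalent root by the number \<open>m\<close> of faces at the root.
  A finite check over the ways in which the three strands leaving the root can return to it shows that
  \<open>m\<close> alone determines how the 16 extensions of the rotation system to the next claw distribute over the
  classes and change the number of faces. With \<open>A\<close>, \<open>B\<close>, \<open>C\<close> the genus
  polynomials of the classes \<open>m = 3\<close>, \<open>m = 2\<close>, \<open>m = 1\<close>, one claw extension maps them to
  \<open>2 B + 8 C\<close>, \<open>12 z (A + B)\<close>, \<open>z (4 z A + 2 B + 8 C)\<close>. Eliminating the classes gives
  \<open>\<Gamma>\<^sub>n = 20 z \<Gamma>\<^sub>n\<^sub>-\<^sub>1 + 8 z (3 - 8 z) \<Gamma>\<^sub>n\<^sub>-\<^sub>2 - 384 z^3 \<Gamma>\<^sub>n\<^sub>-\<^sub>3\<close>. After division by the powers of \<open>z\<close>, all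
  terms of the recurrence that do not vanish at a root of \<open>W\<^sub>n\<^sub>-\<^sub>1\<close> have the same sign there, by the earlier
  interlacing; likewise at the roots of \<open>W\<^sub>n\<^sub>-\<^sub>2\<close>. These alternating signs, the sign at \<open>0\<close> and the sign
  at \<open>-\<infinity>\<close> locate all roots of \<open>W\<^sub>n\<close>.
\<close>


section \<open>First-return maps of permutations\<close>

text \<open>The graphs grow with \<open>n\<close>, so their faces cannot be traced by evaluation.
  But a claw extension creates only 18 darts: a face that meets neither these nor the old root
  survives as the same set, and for counting the others only the order in which they visit the 18
  darts matters. This order is a first-return map on a finite type, determined by the return pattern
  of the strands and five rotations (old root, three subdividing vertices, new root), hence 6 * 2
  patterns with 16 extensions each. An extension adds four vertices and six edges, so gaining
  \<open>2 - 2 * d\<close> faces means raising the genus by \<open>d\<close>; this explains the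
  powers of \<open>z\<close> in the transfer rule. The recurrence has order three, so at a root of
  one polynomial two terms of unknown sign remain; hence the induction carries the interlacing of
  all three pairs among three successive polynomials. The polynomial of index \<open>-1\<close> is a
  constant, with which alternation is vacuous, so a single numerical comparison is left at the
  start.\<close>

definition hits :: "('a \<Rightarrow> 'a) \<Rightarrow> 'a set \<Rightarrow> 'a \<Rightarrow> 'a \<Rightarrow> bool" where
  "hits f C x y \<longleftrightarrow> y \<in> C \<and> (\<exists>n>0. (f ^^ n) x = y \<and> (\<forall>m. 0 < m \<and> m < n \<longrightarrow> (f ^^ m) x \<notin> C))"

lemma hits_step: "f x = y \<Longrightarrow> y \<in> C \<Longrightarrow> hits f C x y"
  unfolding hits_def by (auto intro!: exI[of _ "1::nat"])

text \<open>Finite permutations are recurrent: \<open>x\<close> lies on its own orbit, so a least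
  positive return time exists.\<close>

lemma hits_exists:
  assumes f: "f permutes A" "finite A" and x: "x \<in> C"
  shows "\<exists>y. hits f C x y"
proof -
  have "x \<in> orbit f x"
    using f by (intro permutation_self_in_orbit) (auto simp: permutation_permutes)
  then have ex: "\<exists>n. n > 0 \<and> (f ^^ n) x \<in> C"
    using x by (auto simp: orbit_altdef)
  define n where "n = (LEAST n. n > 0 \<and> (f ^^ n) x \<in> C)"
  have "n > 0 \<and> (f ^^ n) x \<in> C"
    unfolding n_def by (rule LeastI_ex[OF ex])
  moreover have "(f ^^ m) x \<notin> C" if "0 < m" "m < n" for m
    using that not_less_Least unfolding n_def by blast
  ultimately show ?thesis unfolding hits_def by blast
qed

text \<open>Cancelling the shorter path from the longer one shows that the longer one visits the
  starting point of the shorter one at time \<open>n' - n\<close>; as that point lies in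
  \<open>C\<close>, this is an early return unless the times agree.\<close>

lemma hits_inj:
  assumes f: "inj f" and "hits f C x y" "hits f C x' y" and xC: "x \<in> C" "x' \<in> C"
  shows "x = x'"
proof -
  have wlog: "x = x'"
    if le: "n \<le> n'" and n: "0 < n" "(f ^^ n) x = y"
      and n': "(f ^^ n') x' = y" "\<forall>m. 0 < m \<and> m < n' \<longrightarrow> (f ^^ m) x' \<notin> C" and "x \<in> C"
    for n n' :: nat and x x' y
  proof -
    have "(f ^^ n) ((f ^^ (n' - n)) x') = (f ^^ n) x"
      using le n n' by (metis comp_apply funpow_add le_add_diff_inverse)
    then have eq: "(f ^^ (n' - n)) x' = x"
      by (rule injD[OF inj_fn[OF f]])
    with n'(2) \<open>x \<in> C\<close> n(1) show ?thesis
      by (cases "n' - n = 0") auto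
  qed
  from assms obtain n n' where
    "0 < n" "(f ^^ n) x = y" "\<forall>m. 0 < m \<and> m < n \<longrightarrow> (f ^^ m) x \<notin> C"
    "0 < n'" "(f ^^ n') x' = y" "\<forall>m. 0 < m \<and> m < n' \<longrightarrow> (f ^^ m) x' \<notin> C"
    unfolding hits_def by blast
  then show ?thesis
    using wlog[of n n' x y x'] wlog[of n' n x' y x] xC by (cases "n \<le> n'") auto
qed

text \<open>Compares a large permutation \<open>f\<close> with a small model \<open>g\<close> of its
  first-return map to the points coded by \<open>X\<close>. The aim is to count orbits of
  \<open>f\<close> by evaluating \<open>g\<close>, whose codes form a finite type.\<close>

locale first_return =
  fixes f :: "'a \<Rightarrow> 'a" and A :: "'a set" and X :: "'c set" and e :: "'c \<Rightarrow> 'a" and g :: "'c \<Rightarrow> 'c"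
  assumes f: "f permutes A" "finite A"
    and inj: "inj_on e X" and eX: "e ` X \<subseteq> A"
    and gX: "c \<in> X \<Longrightarrow> g c \<in> X"
    and hit: "c \<in> X \<Longrightarrow> hits f (e ` X) (e c) (e (g c))"
begin

lemma perm: "permutation f"
  using f by (auto simp: permutation_permutes)

lemma orbit_eqI_common: "z \<in> orbit f x \<Longrightarrow> z \<in> orbit f y \<Longrightarrow> orbit f x = orbit f y"
  using cyclic_on_orbit'[OF perm] orbit_cyclic_eq3 by metis

lemma g_orbit_subset: "c \<in> X \<Longrightarrow> orbit g c \<subseteq> X"
proof
  fix d assume "d \<in> orbit g c" "c \<in> X"
  then show "d \<in> X" by induction (auto simp: gX)
qed

lemma e_g_in_orbit:
  assumes "c \<in> X" shows "e (g c) \<in> orbit f (e c)"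
proof -
  obtain n where "0 < n" "(f ^^ n) (e c) = e (g c)"
    using hit[OF assms] unfolding hits_def by blast
  then show ?thesis unfolding orbit_altdef by force
qed

text \<open>An \<open>f\<close>-path between marked points splits at its returns, and each piece is
  one application of \<open>g\<close>. The strong induction is on the length of the path, which
  drops by the first return time.\<close>

lemma orbit_Int: 
  assumes c: "c \<in> X"
  shows "orbit f (e c) \<inter> e ` X = e ` orbit g c"
proof
  show "e ` orbit g c \<subseteq> orbit f (e c) \<inter> e ` X"
  proof clarify
    fix d assume d: "d \<in> orbit g c"
    then have "e d \<in> orbit f (e c)"
      by induction (use c g_orbit_subset e_g_in_orbit in \<open>blast intro: orbit_trans\<close>)+
    with d show "e d \<in> orbit f (e c) \<inter> e ` X"
      using g_orbit_subset[OF c] by auto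
  qed
next
  have "(f ^^ n) (e c) \<in> e ` X \<Longrightarrow> 0 < n \<Longrightarrow> c \<in> X \<Longrightarrow> (f ^^ n) (e c) \<in> e ` orbit g c" for n
  proof (induction n arbitrary: c rule: less_induct)
    case (less n)
    obtain k where k: "0 < k" "(f ^^ k) (e c) = e (g c)"
        "\<forall>m. 0 < m \<and> m < k \<longrightarrow> (f ^^ m) (e c) \<notin> e ` X"
      using hit[OF less.prems(3)] unfolding hits_def by blast
    have "k \<le> n" using k(3) less.prems(1,2) by (meson not_le)
    show ?case
    proof (cases "k = n")
      case True
      then show ?thesis using k(2) by (auto intro: orbit.base)
    next
      case False
      with \<open>k \<le> n\<close> have "k < n" by simp
      have eq: "(f ^^ n) (e c) = (f ^^ (n - k)) (e (g c))"
        using \<open>k \<le> n\<close> k(2) by (metis comp_apply funpow_add le_add_diff_inverse2)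
      have "(f ^^ (n - k)) (e (g c)) \<in> e ` orbit g (g c)"
        using less.IH[of "n - k" "g c"] less.prems gX k(1) \<open>k < n\<close> eq by auto
      then show ?thesis unfolding eq by (auto intro: orbit_subset)
    qed
  qed
  then show "orbit f (e c) \<inter> e ` X \<subseteq> e ` orbit g c"
    using c unfolding orbit_altdef[of f] by blast
qed

lemma preimage_orbit:
  assumes "c \<in> X" shows "{d \<in> X. e d \<in> orbit f (e c)} = orbit g c"
proof -
  have "{d \<in> X. e d \<in> orbit f (e c)} = {d \<in> X. e d \<in> e ` orbit g c}"
    using orbit_Int[OF assms] by blast
  also have "\<dots> = orbit g c"
    using g_orbit_subset[OF assms] inj by (auto dest: inj_onD)
  finally show ?thesis .
qed

lemma self_in_g_orbit: "c \<in> X \<Longrightarrow> c \<in> orbit g c"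
  using preimage_orbit[of c] permutation_self_in_orbit[OF perm] by auto

text \<open>Pulling an orbit back to its codes loses nothing, since an orbit of \<open>f\<close>
  through a marked point is determined by that point.\<close>

lemma card_orbits_of_codes:
  assumes "Z \<subseteq> X"
  shows "card ((\<lambda>c. orbit f (e c)) ` Z) = card (orbit g ` Z)"
proof -
  let ?p = "\<lambda>S. {d \<in> X. e d \<in> S}"
  have p: "?p (orbit f (e c)) = orbit g c" if "c \<in> Z" for c
    using that assms preimage_orbit by blast
  have "inj_on ?p ((\<lambda>c. orbit f (e c)) ` Z)"
  proof (rule inj_onI, clarify)
    fix c d assume cd: "c \<in> Z" "d \<in> Z" and eq: "?p (orbit f (e c)) = ?p (orbit f (e d))"
    then have "c \<in> ?p (orbit f (e d))"
      using permutation_self_in_orbit[OF perm, of "e c"] assms by auto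
    then have "e c \<in> orbit f (e d)" by simp
    then show "orbit f (e c) = orbit f (e d)"
      using orbit_eqI_common permutation_self_in_orbit[OF perm] by blast
  qed
  then have "card ((\<lambda>c. orbit f (e c)) ` Z) = card (?p ` (\<lambda>c. orbit f (e c)) ` Z)"
    by (simp add: card_image)
  also have "?p ` (\<lambda>c. orbit f (e c)) ` Z = orbit g ` Z"
    using p by (force simp: image_image)
  finally show ?thesis .
qed

lemma orbits_meeting:
  assumes "Y \<subseteq> X"
  shows "{S \<in> orbit f ` A. S \<inter> e ` Y \<noteq> {}} = (\<lambda>c. orbit f (e c)) ` Y"
proof (intro subset_antisym subsetI)
  fix S assume "S \<in> {S \<in> orbit f ` A. S \<inter> e ` Y \<noteq> {}}"
  then obtain x c where S: "S = orbit f x" "c \<in> Y" "e c \<in> orbit f x" by blast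
  then have "S = orbit f (e c)"
    using orbit_eqI_common permutation_self_in_orbit[OF perm] by blast
  with S show "S \<in> (\<lambda>c. orbit f (e c)) ` Y" by blast
next
  fix S assume "S \<in> (\<lambda>c. orbit f (e c)) ` Y"
  then obtain c where "c \<in> Y" "S = orbit f (e c)" by blast
  then show "S \<in> {S \<in> orbit f ` A. S \<inter> e ` Y \<noteq> {}}"
    using assms eX permutation_self_in_orbit[OF perm, of "e c"] by blast
qed

text \<open>Two orbits of \<open>g\<close> with a common code agree because the orbits of
  \<open>f\<close> through the corresponding points do.\<close>

lemma g_orbits_meeting:
  assumes "Y \<subseteq> X"
  shows "orbit g ` Y = {S \<in> orbit g ` X. S \<inter> Y \<noteq> {}}"
proof (intro subset_antisym subsetI)
  fix S assume "S \<in> orbit g ` Y"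
  then show "S \<in> {S \<in> orbit g ` X. S \<inter> Y \<noteq> {}}"
    using assms self_in_g_orbit by blast
next
  fix S assume "S \<in> {S \<in> orbit g ` X. S \<inter> Y \<noteq> {}}"
  then obtain c d where S: "S = orbit g c" "c \<in> X" "d \<in> Y" "d \<in> orbit g c" by blast
  then have "e d \<in> orbit f (e c)" using preimage_orbit[of c] by blast
  then have "orbit f (e d) = orbit f (e c)"
    using orbit_eqI_common permutation_self_in_orbit[OF perm] by blast
  then have "orbit g d = orbit g c"
    using preimage_orbit[of c] preimage_orbit[of d] S assms by auto
  then show "S \<in> orbit g ` Y" using S by blast
qed

lemma card_orbits_meeting:
  assumes "Y \<subseteq> X"
  shows "card {S \<in> orbit f ` A. S \<inter> e ` Y \<noteq> {}} = card {S \<in> orbit g ` X. S \<inter> Y \<noteq> {}}"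
  by (simp only: orbits_meeting[OF assms] card_orbits_of_codes[OF assms] g_orbits_meeting[OF assms])

text \<open>An orbit that avoids the codes in \<open>Y\<close> either avoids all marked points or is
  seen by \<open>g\<close> as an orbit outside \<open>Y\<close>. With \<open>Y\<close> the codes at
  the new root, these are the faces left intact by the extension and the changed faces away from the
  new root.\<close>

lemma card_orbits_avoiding:
  assumes "Y \<subseteq> X"
  shows "card {S \<in> orbit f ` A. S \<inter> e ` Y = {}} =
    card {S \<in> orbit f ` A. S \<inter> e ` X = {}} + card {S \<in> orbit g ` X. S \<inter> Y = {}}"
proof -
  let ?Z = "{c \<in> X. orbit g c \<inter> Y = {}}"
  have avoid: "orbit f (e c) \<inter> e ` Y = {} \<longleftrightarrow> orbit g c \<inter> Y = {}" if "c \<in> X" for c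
  proof -
    have "orbit f (e c) \<inter> e ` Y = (orbit f (e c) \<inter> e ` X) \<inter> e ` Y" using assms by auto
    also have "\<dots> = e ` (orbit g c \<inter> Y)"
      using orbit_Int[OF that] inj_on_image_Int[OF inj g_orbit_subset[OF that] assms] by simp
    finally show ?thesis by simp
  qed
  have "{S \<in> orbit f ` A. S \<inter> e ` Y = {}} =
      {S \<in> orbit f ` A. S \<inter> e ` X = {}} \<union> {S \<in> orbit f ` A. S \<inter> e ` X \<noteq> {} \<and> S \<inter> e ` Y = {}}"
    using assms by blast
  also have "{S \<in> orbit f ` A. S \<inter> e ` X \<noteq> {} \<and> S \<inter> e ` Y = {}} =
      {S \<in> (\<lambda>c. orbit f (e c)) ` X. S \<inter> e ` Y = {}}"
    unfolding orbits_meeting[of X, OF order_refl, symmetric] by blast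
  also have "\<dots> = (\<lambda>c. orbit f (e c)) ` ?Z"
    using avoid by blast
  finally have eq: "{S \<in> orbit f ` A. S \<inter> e ` Y = {}} =
      {S \<in> orbit f ` A. S \<inter> e ` X = {}} \<union> (\<lambda>c. orbit f (e c)) ` ?Z" .
  have disj: "{S \<in> orbit f ` A. S \<inter> e ` X = {}} \<inter> (\<lambda>c. orbit f (e c)) ` ?Z = {}"
    using permutation_self_in_orbit[OF perm] by blast
  have fin: "finite {S \<in> orbit f ` A. S \<inter> e ` X = {}}" "finite ((\<lambda>c. orbit f (e c)) ` ?Z)"
    using f(2) finite_imageD[OF finite_subset[OF eX f(2)] inj] by simp_all
  have img: "orbit g ` ?Z = {S \<in> orbit g ` X. S \<inter> Y = {}}" by auto
  show ?thesis
    unfolding eq card_Un_disjoint[OF fin disj] card_orbits_of_codes[of ?Z, OF Collect_restrict] img ..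
qed

end

section \<open>Cycles given as lists, checkable by evaluation\<close>

definition cycle_decomp :: "('a \<Rightarrow> 'a) \<Rightarrow> 'a list list \<Rightarrow> bool" where
  "cycle_decomp f Cs \<longleftrightarrow> distinct (concat Cs) \<and> list_all (\<lambda>C. C \<noteq> [] \<and> map f C = rotate1 C) Cs"

lemma orbit_cycle_list:
  assumes "map f C = rotate1 C" "c \<in> set C"
  shows "orbit f c = set C"
proof -
  obtain i where i: "i < length C" "c = C ! i"
    using assms(2) by (metis in_set_conv_nth)
  have f: "f (C ! k) = C ! (Suc k mod length C)" if "k < length C" for k
    using that assms(1) nth_rotate1[OF that] by (metis nth_map)
  have pow: "(f ^^ n) c = C ! ((i + n) mod length C)" for n
  proof (induction n)
    case (Suc n)
    have "(i + n) mod length C < length C" using i by (intro mod_less_divisor) linarith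
    then show ?case using Suc f by (simp add: mod_Suc_eq)
  qed (use i in simp)
  show ?thesis
  proof (intro subset_antisym subsetI)
    fix y assume "y \<in> orbit f c"
    moreover have "C \<noteq> []" using i by auto
    ultimately show "y \<in> set C" by (auto simp: orbit_altdef pow)
  next
    fix y assume "y \<in> set C"
    then obtain m where m: "m < length C" "y = C ! m" by (metis in_set_conv_nth)
    \<comment> \<open>Adding the length before subtracting \<open>i\<close> keeps the exponent
      positive, as \<open>orbit\<close> requires, and leaves the position modulo the length
      unchanged.\<close>
    then have "y = (f ^^ (m + length C - i)) c" using i(1) by (simp add: pow)
    moreover have "0 < m + length C - i" using i by simp
    ultimately show "y \<in> orbit f c" unfolding orbit_altdef by blast
  qed
qed

text \<open>The concatenation is distinct and no list is empty, so different lists have different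
  underlying sets and counting lists counts orbits.\<close>

lemma card_orbits_cycle_decomp:
  assumes "cycle_decomp f Cs"
  shows "card {S \<in> orbit f ` set (concat Cs). P S} = length (filter (\<lambda>C. P (set C)) Cs)"
proof -
  have orb: "orbit f c = set C" if "C \<in> set Cs" "c \<in> set C" for C c
    using that assms by (auto simp: cycle_decomp_def list_all_iff intro!: orbit_cycle_list)
  have ne: "C \<noteq> []" if "C \<in> set Cs" for C
    using that assms by (auto simp: cycle_decomp_def list_all_iff)
  have "orbit f ` set (concat Cs) = set ` set Cs"
  proof (intro subset_antisym subsetI)
    fix S assume "S \<in> set ` set Cs"
    then obtain C where "C \<in> set Cs" "S = set C" by blast
    moreover from this have "hd C \<in> set C" using ne by auto
    ultimately show "S \<in> orbit f ` set (concat Cs)" using orb by auto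
  qed (use orb in auto)
  moreover have "card {S \<in> set ` set Ds. P S} = length (filter (\<lambda>C. P (set C)) Ds)"
    if "distinct (concat Ds)" "\<And>C. C \<in> set Ds \<Longrightarrow> C \<noteq> []" for Ds :: "'a list list"
    using that
  proof (induction Ds)
    case (Cons D Ds)
    have notin: "set D \<notin> set ` set Ds"
    proof
      assume "set D \<in> set ` set Ds"
      then have "set D \<subseteq> set (concat Ds)" by auto
      then show False using Cons.prems by (auto simp: Int_absorb2)
    qed
    have "{S \<in> set ` set (D # Ds). P S} =
        (if P (set D) then insert (set D) {S \<in> set ` set Ds. P S} else {S \<in> set ` set Ds. P S})"
      by auto
    then show ?case using Cons notin by auto
  qed simp
  ultimately show ?thesis
    using assms ne by (simp add: cycle_decomp_def)
qed


section \<open>Local face tracing in a claw extension\<close>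

text \<open>
  The darts created by a claw extension are coded by a kind and the index of the strand at
  the old root \<open>u\<close> on which they lie: \<open>A\<close> is the old neighbour of \<open>u\<close>, \<open>W\<close> the subdividing vertex,
  \<open>U\<close> the vertex \<open>u\<close> itself and \<open>R\<close> the new root, so that \<open>WA\<close> runs from \<open>W\<close> to \<open>A\<close>, and so on.
  In any rooted graph \<open>RW\<close> and \<open>WR\<close> code the darts leaving and entering the root.
\<close>

datatype idx = I0 | I1 | I2
datatype kind = WA | AW | WU | UW | RW | WR

fun tri :: "'a \<times> 'a \<times> 'a \<Rightarrow> idx \<Rightarrow> 'a" where
  "tri (x, y, z) I0 = x" | "tri (x, y, z) I1 = y" | "tri (x, y, z) I2 = z"

text \<open>These are the only two cyclic orders of three darts; hence a boolean encodes a rotation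
  at a trivalent vertex.\<close>

definition turn :: "bool \<Rightarrow> idx \<Rightarrow> idx" where
  "turn b = tri (if b then (I1, I2, I0) else (I2, I0, I1))"

text \<open>
  First-return maps of the face permutation to the coded darts. A face that leaves the old root
  on strand \<open>i\<close> comes back on strand \<open>p i\<close>; \<open>b\<close>, \<open>t i\<close> and \<open>s\<close> are the rotations at the old root, at the
  subdividing vertices and at the new root. A subdividing vertex with \<open>t i = True\<close> has rotation
  \<open>(R A U)\<close>.
\<close>

fun root_return :: "(idx \<Rightarrow> idx) \<Rightarrow> bool \<Rightarrow> kind \<times> idx \<Rightarrow> kind \<times> idx" where
  "root_return p b (RW, i) = (WR, p i)"
| "root_return p b (WR, i) = (RW, turn b i)"
| "root_return p b x = x"

fun claw_return :: "(idx \<Rightarrow> idx) \<Rightarrow> bool \<Rightarrow> (idx \<Rightarrow> bool) \<Rightarrow> bool \<Rightarrow> kind \<times> idx \<Rightarrow> kind \<times> idx" where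
  "claw_return p b t s (WA, i) = (AW, p i)"
| "claw_return p b t s (AW, i) = (if t i then WU else WR, i)"
| "claw_return p b t s (WU, i) = (UW, turn b i)"
| "claw_return p b t s (UW, i) = (if t i then WR else WA, i)"
| "claw_return p b t s (RW, i) = (if t i then WA else WU, i)"
| "claw_return p b t s (WR, i) = (RW, turn s i)"

text \<open>
  The number \<open>18\<close> of codes serves as fuel. Nothing is proved about \<open>cycles\<close>: its results are
  validated by \<open>cycle_decomp\<close>.
\<close>

fun cycle_from :: "nat \<Rightarrow> ('a \<Rightarrow> 'a) \<Rightarrow> 'a \<Rightarrow> 'a \<Rightarrow> 'a list" where
  "cycle_from 0 f c x = []"
| "cycle_from (Suc n) f c x = (if x = c then [c] else x # cycle_from n f c (f x))"

fun cycles :: "nat \<Rightarrow> ('a \<Rightarrow> 'a) \<Rightarrow> 'a list \<Rightarrow> 'a list list" where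
  "cycles 0 f cs = []"
| "cycles (Suc n) f [] = []"
| "cycles (Suc n) f (c # cs) =
    (let C = cycle_from 18 f c (f c) in C # cycles n f (filter (\<lambda>x. \<not> List.member C x) cs))"

definition all_codes :: "kind list \<Rightarrow> (kind \<times> idx) list" where
  "all_codes ks = [(k, i). k \<leftarrow> ks, i \<leftarrow> [I0, I1, I2]]"

definition root_codes :: "(kind \<times> idx) set" where
  "root_codes = {RW, WR} \<times> UNIV"

definition meets_root :: "(kind \<times> idx) list \<Rightarrow> bool" where
  "meets_root C = list_ex (\<lambda>(k, i). k = RW \<or> k = WR) C"

definition root_decomp :: "idx \<times> idx \<times> idx \<Rightarrow> bool \<Rightarrow> (kind \<times> idx) list list" where
  "root_decomp p b = cycles 6 (root_return (tri p) b) (all_codes [RW, WR])"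

definition claw_decomp ::
    "idx \<times> idx \<times> idx \<Rightarrow> bool \<Rightarrow> bool \<times> bool \<times> bool \<Rightarrow> bool \<Rightarrow> (kind \<times> idx) list list" where
  "claw_decomp p b t s =
     cycles 18 (claw_return (tri p) b (tri t) s) (all_codes [WA, AW, WU, UW, RW, WR])"

text \<open>Outcomes are pairs of the number of faces at the new root and the number of new faces away from it.\<close>

definition outcome :: "idx \<times> idx \<times> idx \<Rightarrow> bool \<Rightarrow> bool \<times> bool \<times> bool \<Rightarrow> bool \<Rightarrow> nat \<times> nat" where
  "outcome p b t s = (let Cs = claw_decomp p b t s in
     (length (filter meets_root Cs), length (filter (\<lambda>C. \<not> meets_root C) Cs)))"

definition outcomes :: "idx \<times> idx \<times> idx \<Rightarrow> bool \<Rightarrow> (nat \<times> nat) list" where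
  "outcomes p b = [outcome p b (t0, t1, t2) s.
     t0 \<leftarrow> [True, False], t1 \<leftarrow> [True, False], t2 \<leftarrow> [True, False], s \<leftarrow> [True, False]]"

text \<open>Each row lists 16 extensions. An outcome \<open>(m', k')\<close> changes the number of
  faces by \<open>m' + k' - m\<close>, which equals \<open>2 - 2 * d\<close> if the genus rises by
  \<open>d\<close>. So \<open>m = 1\<close> gives 8 outcomes with \<open>d = 0\<close> and 8 with
  \<open>d = 1\<close>; \<open>m = 2\<close> gives 14 with \<open>d = 1\<close> and 2 with
  \<open>d = 0\<close>; \<open>m = 3\<close> gives 4 with \<open>d = 2\<close> and 12 with
  \<open>d = 1\<close>. These are the coefficients of the transfer rule.\<close>

definition expected_outcomes :: "nat \<Rightarrow> (nat \<times> nat) list" where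
  "expected_outcomes m =
    (if m = 1 then replicate 8 (3, 0) @ replicate 8 (1, 0)
     else if m = 2 then replicate 12 (2, 0) @ replicate 2 (3, 1) @ replicate 2 (1, 1)
     else if m = 3 then replicate 4 (1, 0) @ replicate 12 (2, 1) else [])"

text \<open>An executable form of equality of multisets.\<close>

fun rearranged :: "'a list \<Rightarrow> 'a list \<Rightarrow> bool" where
  "rearranged [] ys \<longleftrightarrow> ys = []"
| "rearranged (x # xs) ys \<longleftrightarrow> List.member ys x \<and> rearranged xs (remove1 x ys)"

definition perms3 :: "(idx \<times> idx \<times> idx) list" where
  "perms3 = [(I0,I1,I2), (I0,I2,I1), (I1,I0,I2), (I1,I2,I0), (I2,I0,I1), (I2,I1,I0)]"

text \<open>The return pattern matters only through the number of root faces. This observation about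
  the 12 patterns is what closes the system on three classes.\<close>

lemma all_outcomes:
  "list_all (\<lambda>p. list_all (\<lambda>b. rearranged (expected_outcomes (length (root_decomp p b))) (outcomes p b))
     [True, False]) perms3"
  by code_simp

text \<open>Validates the lists counted in the preceding check: they are genuine disjoint cycles and
  exhaust the codes, so their number is a number of orbits.\<close>

lemma all_cycle_decomps:
  "list_all (\<lambda>p. list_all (\<lambda>b.
     cycle_decomp (root_return (tri p) b) (root_decomp p b) \<and>
     list_all (List.member (concat (root_decomp p b))) (all_codes [RW, WR]) \<and>
     list_all (\<lambda>(k, i). k = RW \<or> k = WR) (concat (root_decomp p b)) \<and>
     list_all (\<lambda>t0. list_all (\<lambda>t1. list_all (\<lambda>t2. list_all (\<lambda>s.
        cycle_decomp (claw_return (tri p) b (tri (t0, t1, t2)) s) (claw_decomp p b (t0, t1, t2) s) \<and>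
        list_all (List.member (concat (claw_decomp p b (t0, t1, t2) s))) (all_codes [WA, AW, WU, UW, RW, WR]))
          [True, False]) [True, False]) [True, False]) [True, False])
     [True, False]) perms3"
  by code_simp

text \<open>In the dipole the strands return by the rotation at \<open>Base\<close>, so the pattern
  is itself a turn. Equal turns give the torus with one face, opposite turns the sphere with
  three.\<close>

lemma root_decomps_dipole:
  "length (root_decomp (I1, I2, I0) True) = 1 \<and> length (root_decomp (I1, I2, I0) False) = 3 \<and>
   length (root_decomp (I2, I0, I1) True) = 3 \<and> length (root_decomp (I2, I0, I1) False) = 1"
  by code_simp

lemma rearranged_mset: "rearranged xs ys \<Longrightarrow> mset xs = mset ys"
  by (induction xs arbitrary: ys) auto

lemma bij_idx_tri:
  assumes "bij p"
  obtains q where "p = tri q" "q \<in> set perms3"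
proof
  show "p = tri (p I0, p I1, p I2)"
  proof
    fix i show "p i = tri (p I0, p I1, p I2) i" by (cases i) auto
  qed
  have "p I0 \<noteq> p I1" "p I0 \<noteq> p I2" "p I1 \<noteq> p I2"
    using bij_is_inj[OF assms] by (auto dest: injD)
  then show "(p I0, p I1, p I2) \<in> set perms3"
    by (cases "p I0"; cases "p I1"; cases "p I2") (auto simp: perms3_def)
qed

lemma UNIV_idx: "UNIV = {I0, I1, I2}"
  using idx.exhaust by auto

lemma UNIV_kind: "UNIV = {WA, AW, WU, UW, RW, WR}"
  using kind.exhaust by auto

instance idx :: finite by standard (simp add: UNIV_idx)
instance kind :: finite by standard (simp add: UNIV_kind)

section \<open>From evaluated cycle lists to numbers of faces\<close>

definition root_faces :: "(kind \<times> idx \<Rightarrow> kind \<times> idx) \<Rightarrow> (kind \<times> idx) set \<Rightarrow> nat" where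
  "root_faces f X = card {S \<in> orbit f ` X. S \<inter> root_codes \<noteq> {}}"

definition other_faces :: "(kind \<times> idx \<Rightarrow> kind \<times> idx) \<Rightarrow> (kind \<times> idx) set \<Rightarrow> nat" where
  "other_faces f X = card {S \<in> orbit f ` X. S \<inter> root_codes = {}}"

lemma list_allD: "list_all Q xs \<Longrightarrow> x \<in> set xs \<Longrightarrow> Q x"
  by (simp add: list_all_iff)

lemma list_all_boolD: "list_all Q [True, False] \<Longrightarrow> Q b"
  by (cases b) auto

lemma root_cycle_decomp:
  assumes "p \<in> set perms3"
  shows "cycle_decomp (root_return (tri p) b) (root_decomp p b)"
    and "set (concat (root_decomp p b)) = root_codes"
proof -
  note all = list_all_boolD[OF list_allD[OF all_cycle_decomps assms], of b]
  show "cycle_decomp (root_return (tri p) b) (root_decomp p b)"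
    using all by (rule conjunct1)
  have "set (all_codes [RW, WR]) = root_codes"
    using UNIV_idx by (auto simp: all_codes_def root_codes_def)
  moreover have "set (all_codes [RW, WR]) \<subseteq> set (concat (root_decomp p b))"
    using list_allD[OF all[THEN conjunct2, THEN conjunct1]] unfolding List.member_iff by (rule subsetI)
  moreover have "set (concat (root_decomp p b)) \<subseteq> root_codes"
  proof
    fix c assume "c \<in> set (concat (root_decomp p b))"
    with all[THEN conjunct2, THEN conjunct2, THEN conjunct1]
    have "case c of (k, i) \<Rightarrow> k = RW \<or> k = WR" by (rule list_allD)
    then show "c \<in> root_codes" by (auto simp: root_codes_def)
  qed
  ultimately show "set (concat (root_decomp p b)) = root_codes" by blast
qed

lemma claw_cycle_decomp:
  assumes "p \<in> set perms3"
  shows "cycle_decomp (claw_return (tri p) b (tri (t0, t1, t2)) s) (claw_decomp p b (t0, t1, t2) s)"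
    and "set (concat (claw_decomp p b (t0, t1, t2) s)) = UNIV"
proof -
  note all = list_all_boolD[OF list_allD[OF all_cycle_decomps assms], of b]
  note all = all[THEN conjunct2, THEN conjunct2, THEN conjunct2]
  note all = list_all_boolD[OF list_all_boolD[OF list_all_boolD[OF list_all_boolD[OF all]]], of t0 t1 t2 s]
  show "cycle_decomp (claw_return (tri p) b (tri (t0, t1, t2)) s) (claw_decomp p b (t0, t1, t2) s)"
    using all by (rule conjunct1)
  have "set (all_codes [WA, AW, WU, UW, RW, WR]) = UNIV \<times> UNIV"
    unfolding UNIV_idx UNIV_kind by (auto simp: all_codes_def)
  moreover have "set (all_codes [WA, AW, WU, UW, RW, WR]) \<subseteq> set (concat (claw_decomp p b (t0, t1, t2) s))"
    using list_allD[OF all[THEN conjunct2]] unfolding List.member_iff by (rule subsetI)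
  ultimately show "set (concat (claw_decomp p b (t0, t1, t2) s)) = UNIV" by auto
qed

lemma meets_root_iff: "meets_root C \<longleftrightarrow> set C \<inter> root_codes \<noteq> {}"
  by (auto simp: meets_root_def list_ex_iff root_codes_def)

lemma root_faces_root_return:
  assumes "p \<in> set perms3"
  shows "root_faces (root_return (tri p) b) root_codes = length (root_decomp p b)"
proof -
  let ?Cs = "root_decomp p b"
  note dec = root_cycle_decomp(1)[OF assms, of b] and codes = root_cycle_decomp(2)[OF assms, of b]
  have "set C \<inter> root_codes \<noteq> {}" if "C \<in> set ?Cs" for C
  proof -
    have "C \<noteq> []" using dec that by (auto simp: cycle_decomp_def list_all_iff)
    then have "hd C \<in> set C" by simp
    moreover have "set C \<subseteq> root_codes" using codes that by auto
    ultimately show ?thesis by blast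
  qed
  then have "filter (\<lambda>C. set C \<inter> root_codes \<noteq> {}) ?Cs = ?Cs" by simp
  then show ?thesis
    using card_orbits_cycle_decomp[OF dec, of "\<lambda>S. S \<inter> root_codes \<noteq> {}"]
    unfolding codes root_faces_def by simp
qed

lemma outcome_eq:
  assumes "p \<in> set perms3"
  shows "outcome p b (t0, t1, t2) s =
    (root_faces (claw_return (tri p) b (tri (t0, t1, t2)) s) UNIV,
     other_faces (claw_return (tri p) b (tri (t0, t1, t2)) s) UNIV)"
proof -
  let ?Cs = "claw_decomp p b (t0, t1, t2) s"
  let ?f = "claw_return (tri p) b (tri (t0, t1, t2)) s"
  note dec = claw_cycle_decomp(1)[OF assms, of b t0 t1 t2 s]
    and codes = claw_cycle_decomp(2)[OF assms, of b t0 t1 t2 s]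
  show ?thesis
    using card_orbits_cycle_decomp[OF dec]
    unfolding codes root_faces_def other_faces_def outcome_def Let_def meets_root_iff by simp
qed

text \<open>The transfer rule in dual form: it acts on weights of the two face numbers instead of on
  counts, so that one statement serves every weight. The last branch is meant for
  \<open>m = 3\<close>.\<close>

definition claw_step :: "(nat \<Rightarrow> nat \<Rightarrow> nat) \<Rightarrow> nat \<Rightarrow> nat \<Rightarrow> nat" where
  "claw_step g m k =
    (if m = 1 then 8 * g 3 k + 8 * g 1 k
     else if m = 2 then 12 * g 2 k + 2 * g 3 (k + 1) + 2 * g 1 (k + 1)
     else 4 * g 1 k + 12 * g 2 (k + 1))"

lemma sum_claw_returns:
  assumes "bij p"
  shows "root_faces (root_return p b) root_codes \<in> {1, 2, 3}"
    and "(\<Sum>t0\<in>UNIV. \<Sum>t1\<in>UNIV. \<Sum>t2\<in>UNIV. \<Sum>s\<in>UNIV.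
        g (root_faces (claw_return p b (tri (t0, t1, t2)) s) UNIV)
          (k + other_faces (claw_return p b (tri (t0, t1, t2)) s) UNIV)) =
      claw_step g (root_faces (root_return p b) root_codes) k"
proof -
  obtain q where q: "p = tri q" "q \<in> set perms3" using bij_idx_tri[OF assms] .
  define m where "m = root_faces (root_return p b) root_codes"
  have m: "m = length (root_decomp q b)"
    unfolding m_def q(1) by (rule root_faces_root_return[OF q(2)])
  have "rearranged (expected_outcomes m) (outcomes q b)"
    unfolding m by (rule list_all_boolD[OF list_allD[OF all_outcomes q(2)]])
  then have eq: "mset (expected_outcomes m) = mset (outcomes q b)"
    by (rule rearranged_mset)
  \<comment> \<open>A value of \<open>m\<close> other than 1, 2, 3 would make the expected list
    empty, against the 16 actual outcomes.\<close>
  have "length (outcomes q b) = 16" by (simp add: outcomes_def)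
  then have "expected_outcomes m \<noteq> []" using eq by auto
  then have m123: "m \<in> {1, 2, 3}" by (auto simp: expected_outcomes_def split: if_splits)
  then show "root_faces (root_return p b) root_codes \<in> {1, 2, 3}" unfolding m_def .
  let ?g = "\<lambda>(m, k'). g m (k + k')"
  have "(\<Sum>t0\<in>UNIV. \<Sum>t1\<in>UNIV. \<Sum>t2\<in>UNIV. \<Sum>s\<in>UNIV.
        g (root_faces (claw_return p b (tri (t0, t1, t2)) s) UNIV)
          (k + other_faces (claw_return p b (tri (t0, t1, t2)) s) UNIV)) =
      (\<Sum>t0\<in>UNIV. \<Sum>t1\<in>UNIV. \<Sum>t2\<in>UNIV. \<Sum>s\<in>UNIV. ?g (outcome q b (t0, t1, t2) s))"
    using outcome_eq[OF q(2)] unfolding q(1) by simp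
  also have "\<dots> = sum_list (map ?g (outcomes q b))"
    by (simp add: outcomes_def UNIV_bool)
  also have "\<dots> = sum_list (map ?g (expected_outcomes m))"
    by (simp only: sum_mset_sum_list[symmetric] mset_map eq)
  also have "\<dots> = claw_step g m k"
    using m123 by (auto simp: expected_outcomes_def claw_step_def sum_list_replicate)
  finally show "(\<Sum>t0\<in>UNIV. \<Sum>t1\<in>UNIV. \<Sum>t2\<in>UNIV. \<Sum>s\<in>UNIV.
        g (root_faces (claw_return p b (tri (t0, t1, t2)) s) UNIV)
          (k + other_faces (claw_return p b (tri (t0, t1, t2)) s) UNIV)) =
      claw_step g (root_faces (root_return p b) root_codes) k"
    unfolding m_def .
qed


section \<open>Permutations with prescribed cyclic blocks\<close>

text \<open>Rotation systems seen only through the partition of the darts into stars of vertices. In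
  this form darts can be relabelled and stars added one at a time.\<close>

definition cyclic_perms :: "'a set set \<Rightarrow> ('a \<Rightarrow> 'a) set" where
  "cyclic_perms \<P> = {\<rho>. \<rho> permutes \<Union>\<P> \<and> (\<forall>S\<in>\<P>. cyclic_on \<rho> S)}"

lemma rotation_systems_eq:
  assumes "\<And>x. x \<in> arcs G \<Longrightarrow> tail G x \<in> verts G"
  shows "rotation_systems G = cyclic_perms (out_arcs G ` verts G - {{}})"
proof -
  have "\<Union>(out_arcs G ` verts G - {{}}) = arcs G"
    using assms by (auto simp: out_arcs_def)
  then show ?thesis
    by (auto simp: rotation_systems_def cyclic_perms_def)
qed

text \<open>Conjugation by \<open>h\<close> preserves cycles, and conjugation by its inverse undoes
  it.\<close>

lemma cyclic_perms_image:
  assumes h: "inj_on h (\<Union>\<P>)"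
  shows "bij_betw (map_permutation (\<Union>\<P>) h) (cyclic_perms \<P>) (cyclic_perms ((`) h ` \<P>))"
proof -
  let ?h' = "inv_into (\<Union>\<P>) h"
  have Un: "\<Union>((`) h ` \<P>) = h ` \<Union>\<P>" by auto
  have bij: "bij_betw h (\<Union>\<P>) (h ` \<Union>\<P>)" using h by (simp add: bij_betw_def)
  have bij': "bij_betw ?h' (h ` \<Union>\<P>) (\<Union>\<P>)" using bij by (rule bij_betw_inv_into)
  show ?thesis
  proof (rule bij_betw_byWitness[where f' = "map_permutation (h ` \<Union>\<P>) ?h'"])
    show "\<forall>\<rho>\<in>cyclic_perms \<P>. map_permutation (h ` \<Union>\<P>) ?h' (map_permutation (\<Union>\<P>) h \<rho>) = \<rho>"
    proof
      fix \<rho> assume "\<rho> \<in> cyclic_perms \<P>"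
      then have "\<rho> permutes \<Union>\<P>" unfolding cyclic_perms_def by blast
      then show "map_permutation (h ` \<Union>\<P>) ?h' (map_permutation (\<Union>\<P>) h \<rho>) = \<rho>"
        by (rule map_permutation_compose_inv[OF bij]) (rule inv_into_f_f[OF h])
    qed
    show "\<forall>\<rho>\<in>cyclic_perms ((`) h ` \<P>).
        map_permutation (\<Union>\<P>) h (map_permutation (h ` \<Union>\<P>) ?h' \<rho>) = \<rho>"
    proof
      fix \<rho> assume "\<rho> \<in> cyclic_perms ((`) h ` \<P>)"
      then have "\<rho> permutes h ` \<Union>\<P>" unfolding cyclic_perms_def Un by blast
      then show "map_permutation (\<Union>\<P>) h (map_permutation (h ` \<Union>\<P>) ?h' \<rho>) = \<rho>"
        by (rule map_permutation_compose_inv[OF bij']) (rule f_inv_into_f)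
    qed
    show "map_permutation (\<Union>\<P>) h ` cyclic_perms \<P> \<subseteq> cyclic_perms ((`) h ` \<P>)"
    proof clarify
      fix \<rho> assume "\<rho> \<in> cyclic_perms \<P>"
      then have \<rho>: "\<rho> permutes \<Union>\<P>" "\<And>S. S \<in> \<P> \<Longrightarrow> cyclic_on \<rho> S"
        by (auto simp: cyclic_perms_def)
      have "cyclic_on (map_permutation (\<Union>\<P>) h \<rho>) (h ` S)" if "S \<in> \<P>" for S
        using \<rho>(2)[OF that] by (rule cyclic_on_image) (use that h in \<open>auto intro!: map_permutation_apply\<close>)
      then show "map_permutation (\<Union>\<P>) h \<rho> \<in> cyclic_perms ((`) h ` \<P>)"
        using map_permutation_permutes[OF bij \<rho>(1)] unfolding cyclic_perms_def Un by blast
    qed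
    show "map_permutation (h ` \<Union>\<P>) ?h' ` cyclic_perms ((`) h ` \<P>) \<subseteq> cyclic_perms \<P>"
    proof clarify
      fix \<rho> assume "\<rho> \<in> cyclic_perms ((`) h ` \<P>)"
      then have \<rho>: "\<rho> permutes h ` \<Union>\<P>" "\<And>S. S \<in> \<P> \<Longrightarrow> cyclic_on \<rho> (h ` S)"
        unfolding cyclic_perms_def Un by auto
      have "cyclic_on (map_permutation (h ` \<Union>\<P>) ?h' \<rho>) S" if "S \<in> \<P>" for S
      proof -
        have "cyclic_on (map_permutation (h ` \<Union>\<P>) ?h' \<rho>) (?h' ` h ` S)"
          using \<rho>(2)[OF that] by (rule cyclic_on_image)
            (use that in \<open>auto intro!: map_permutation_apply inj_on_inv_into\<close>)
        also have "?h' ` h ` S = S"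
          using that by (intro inv_into_image_cancel[OF h]) auto
        finally show ?thesis .
      qed
      then show "map_permutation (h ` \<Union>\<P>) ?h' \<rho> \<in> cyclic_perms \<P>"
        using map_permutation_permutes[OF bij' \<rho>(1)] unfolding cyclic_perms_def by blast
    qed
  qed
qed

lemma cyclic_on_bij_betw: "cyclic_on f S \<Longrightarrow> bij_betw f S S"
proof -
  assume f: "cyclic_on f S"
  have "f ` S = S"
  proof
    show "f ` S \<subseteq> S" using f by (auto intro: cyclic_on_inI)
    show "S \<subseteq> f ` S"
    proof
      fix s assume s: "s \<in> S"
      then have "s \<in> orbit f s" using orbit_cyclic_eq3[OF f s] by simp
      then show "s \<in> f ` S"
        by cases (use orbit_cyclic_eq3[OF f s] s in auto)
    qed
  qed
  then show "bij_betw f S S"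
    using finite_cyclic_on[OF f] eq_card_imp_inj_on[of S f] by (auto simp: bij_betw_def)
qed

lemma perm_restrict_permutes:
  assumes "cyclic_on f S" shows "perm_restrict f S permutes S"
proof (rule bij_imp_permutes)
  have "bij_betw (perm_restrict f S) S S \<longleftrightarrow> bij_betw f S S"
    by (rule bij_betw_cong) (simp add: perm_restrict_def)
  then show "bij_betw (perm_restrict f S) S S" using cyclic_on_bij_betw[OF assms] by simp
qed (simp add: perm_restrict_def)

text \<open>The factors have disjoint supports, so each is recovered from the product by
  restriction.\<close>

lemma cyclic_perms_insert:
  assumes disj: "S \<inter> \<Union>\<P> = {}"
  shows "bij_betw (\<lambda>(\<rho>, \<sigma>). \<rho> \<circ> \<sigma>) (cyclic_perms \<P> \<times> cyclic_perms {S}) (cyclic_perms (insert S \<P>))"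
proof -
  let ?f' = "\<lambda>\<tau>. (perm_restrict \<tau> (\<Union>\<P>), perm_restrict \<tau> S)"
  have app: "(\<rho> \<circ> \<sigma>) x = (if x \<in> S then \<sigma> x else \<rho> x)"
    if "\<rho> permutes \<Union>\<P>" "\<sigma> permutes S" for \<rho> \<sigma> x
    using that disj permutes_in_image[of \<sigma> S x] permutes_not_in[of \<rho> "\<Union>\<P>" "\<sigma> x"] permutes_not_in[of \<sigma> S x]
    by auto
  show ?thesis
  proof (rule bij_betw_byWitness[where f' = ?f'])
    show "\<forall>a\<in>cyclic_perms \<P> \<times> cyclic_perms {S}. ?f' (case a of (\<rho>, \<sigma>) \<Rightarrow> \<rho> \<circ> \<sigma>) = a"
    proof
      fix a assume "a \<in> cyclic_perms \<P> \<times> cyclic_perms {S}"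
      then obtain \<rho> \<sigma> where a: "a = (\<rho>, \<sigma>)" "\<rho> \<in> cyclic_perms \<P>" "\<sigma> \<in> cyclic_perms {S}"
        by blast
      then have perm: "\<rho> permutes \<Union>\<P>" "\<sigma> permutes S" by (auto simp: cyclic_perms_def)
      have "perm_restrict (\<rho> \<circ> \<sigma>) (\<Union>\<P>) x = \<rho> x" "perm_restrict (\<rho> \<circ> \<sigma>) S x = \<sigma> x" for x
        using disj permutes_not_in[OF perm(1), of x] permutes_not_in[OF perm(2), of x]
        unfolding perm_restrict_def app[OF perm] by auto
      then show "?f' (case a of (\<rho>, \<sigma>) \<Rightarrow> \<rho> \<circ> \<sigma>) = a"
        by (simp add: a(1) fun_eq_iff)
    qed
    show "\<forall>\<tau>\<in>cyclic_perms (insert S \<P>). (case ?f' \<tau> of (\<rho>, \<sigma>) \<Rightarrow> \<rho> \<circ> \<sigma>) = \<tau>"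
    proof
      fix \<tau> assume "\<tau> \<in> cyclic_perms (insert S \<P>)"
      then have \<tau>: "\<tau> permutes S \<union> \<Union>\<P>" "cyclic_on \<tau> S" by (auto simp: cyclic_perms_def)
      have "perm_restrict \<tau> (\<Union>\<P>) (perm_restrict \<tau> S x) = \<tau> x" for x
      proof (cases "x \<in> S")
        case True
        then have "\<tau> x \<in> S" by (rule cyclic_on_inI[OF \<tau>(2)])
        then have "\<tau> x \<notin> \<Union>\<P>" using disj by blast
        then show ?thesis using True by (simp only: perm_restrict_def if_True if_False)
      next
        case False
        then show ?thesis
          using permutes_not_in[OF \<tau>(1), of x]
          by (cases "x \<in> \<Union>\<P>") (simp_all only: perm_restrict_def if_True if_False Un_iff simp_thms)
      qed
      then show "(case ?f' \<tau> of (\<rho>, \<sigma>) \<Rightarrow> \<rho> \<circ> \<sigma>) = \<tau>"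
        by (simp add: fun_eq_iff)
    qed
    show "(\<lambda>(\<rho>, \<sigma>). \<rho> \<circ> \<sigma>) ` (cyclic_perms \<P> \<times> cyclic_perms {S}) \<subseteq> cyclic_perms (insert S \<P>)"
    proof clarify
      fix \<rho> \<sigma> assume "\<rho> \<in> cyclic_perms \<P>" "\<sigma> \<in> cyclic_perms {S}"
      then have \<rho>: "\<rho> permutes \<Union>\<P>" "\<And>T. T \<in> \<P> \<Longrightarrow> cyclic_on \<rho> T"
        and \<sigma>: "\<sigma> permutes S" "cyclic_on \<sigma> S"
        by (auto simp: cyclic_perms_def)
      have "\<rho> \<circ> \<sigma> permutes \<Union>(insert S \<P>)"
        using \<rho>(1) \<sigma>(1) by (intro permutes_compose) (auto intro: permutes_subset)
      moreover have "cyclic_on (\<rho> \<circ> \<sigma>) T" if "T \<in> \<P>" for T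
        using that disj \<rho> \<sigma> by (intro permutes_comp_preserves_cyclic1[of \<sigma> S \<rho> T "\<Union>\<P>"]) auto
      moreover have "cyclic_on (\<rho> \<circ> \<sigma>) S"
        using disj \<rho> \<sigma> by (intro permutes_comp_preserves_cyclic2[of \<rho> "\<Union>\<P>" \<sigma> S S]) auto
      ultimately show "\<rho> \<circ> \<sigma> \<in> cyclic_perms (insert S \<P>)" by (simp add: cyclic_perms_def)
    qed
    show "?f' ` cyclic_perms (insert S \<P>) \<subseteq> cyclic_perms \<P> \<times> cyclic_perms {S}"
    proof (rule image_subsetI)
      fix \<tau> assume "\<tau> \<in> cyclic_perms (insert S \<P>)"
      then have \<tau>: "\<tau> permutes S \<union> \<Union>\<P>" "cyclic_on \<tau> S" "\<And>T. T \<in> \<P> \<Longrightarrow> cyclic_on \<tau> T"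
        by (auto simp: cyclic_perms_def)
      have "S \<union> \<Union>\<P> - S = \<Union>\<P>" using disj by blast
      then have "perm_restrict \<tau> (\<Union>\<P>) permutes \<Union>\<P>"
        using perm_restrict_diff_cyclic[OF \<tau>(1,2)] by simp
      moreover have "cyclic_on (perm_restrict \<tau> (\<Union>\<P>)) T" if "T \<in> \<P>" for T
      proof -
        have "cyclic_on (perm_restrict \<tau> (\<Union>\<P>)) T \<longleftrightarrow> cyclic_on \<tau> T"
          by (rule cyclic_cong) (use that in \<open>auto simp: perm_restrict_def\<close>)
        then show ?thesis using \<tau>(3)[OF that] by simp
      qed
      ultimately show "?f' \<tau> \<in> cyclic_perms \<P> \<times> cyclic_perms {S}"
        using perm_restrict_permutes[OF \<tau>(2)] \<tau>(2)
        by (simp add: cyclic_perms_def cyclic_on_perm_restrict)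
    qed
  qed
qed

section \<open>Rotations at a trivalent vertex\<close>

definition rot3 :: "(idx \<Rightarrow> 'a) \<Rightarrow> bool \<Rightarrow> 'a \<Rightarrow> 'a" where
  "rot3 d b = map_permutation UNIV d (turn b)"

lemma rot3_apply: "inj d \<Longrightarrow> rot3 d b (d i) = d (turn b i)"
  unfolding rot3_def by (rule map_permutation_apply) auto

lemma rot3_outside: "x \<notin> range d \<Longrightarrow> rot3 d b x = x"
  unfolding rot3_def map_permutation_def restrict_id_def by simp

text \<open>A cyclic permutation of three elements has no fixed point, and among the six bijections
  only the two 3-cycles have none.\<close>

lemma cyclic_perms_idx: "cyclic_perms {UNIV :: idx set} = range turn"
proof (intro subset_antisym subsetI)
  fix p :: "idx \<Rightarrow> idx" assume "p \<in> cyclic_perms {UNIV}"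
  then have p: "bij p" "cyclic_on p UNIV"
    by (auto simp: cyclic_perms_def permutes_bij)
  have fixfree: "p x \<noteq> x" for x
  proof
    assume "p x = x"
    then have "UNIV = {x}"
      using orbit_eq_singleton_iff orbit_cyclic_eq3[OF p(2) UNIV_I] by metis
    then have "I0 \<in> {x}" "I1 \<in> {x}" by blast+
    then show False by simp
  qed
  obtain q where q: "p = tri q" "q \<in> set perms3" using bij_idx_tri[OF p(1)] .
  have "q = (I1, I2, I0) \<or> q = (I2, I0, I1)"
    using q(2) fixfree[of I0] fixfree[of I1] fixfree[of I2] unfolding q(1) perms3_def by auto
  then have "p = turn True \<or> p = turn False" unfolding q(1) turn_def by auto
  then show "p \<in> range turn" by auto
next
  fix p assume "p \<in> range turn"
  then obtain b where p: "p = turn b" by auto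
  let ?C = "if b then [I0, I1, I2] else [I0, I2, I1]"
  have C: "set ?C = UNIV" using UNIV_idx by auto
  have "orbit p I0 = set ?C"
    by (rule orbit_cycle_list) (auto simp: p turn_def)
  then have cyc: "cyclic_on p UNIV" unfolding cyclic_on_def C by blast
  then have "p permutes UNIV"
    using cyclic_on_bij_betw by (auto intro: bij_imp_permutes)
  with cyc show "p \<in> cyclic_perms {UNIV}" by (simp add: cyclic_perms_def)
qed

lemma inj_turn: "inj turn"
proof (rule injI)
  fix a b assume "turn a = turn b"
  then have "turn a I0 = turn b I0" by simp
  then show "a = b" by (cases a; cases b) (auto simp: turn_def)
qed

lemma bij_betw_rot3:
  assumes "inj d" shows "bij_betw (rot3 d) UNIV (cyclic_perms {range d})"
proof -
  have "bij_betw (map_permutation UNIV d) (cyclic_perms {UNIV}) (cyclic_perms {range d})"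
    using cyclic_perms_image[of d "{UNIV}"] assms by simp
  moreover have "bij_betw turn UNIV (cyclic_perms {UNIV})"
    unfolding cyclic_perms_idx using inj_turn by (simp add: bij_betw_def)
  ultimately have "bij_betw (map_permutation UNIV d \<circ> turn) UNIV (cyclic_perms {range d})"
    by (rule bij_betw_trans[rotated])
  then show ?thesis by (simp add: rot3_def[abs_def] comp_def)
qed

lemma sum_cyclic_perms_insert:
  assumes "inj d" "range d \<inter> \<Union>\<P> = {}"
  shows "(\<Sum>\<tau>\<in>cyclic_perms (insert (range d) \<P>). g \<tau>) =
    (\<Sum>\<rho>\<in>cyclic_perms \<P>. \<Sum>b\<in>UNIV. g (\<rho> \<circ> rot3 d b))"
proof -
  have "(\<Sum>\<tau>\<in>cyclic_perms (insert (range d) \<P>). g \<tau>) =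
      (\<Sum>(\<rho>, \<sigma>)\<in>cyclic_perms \<P> \<times> cyclic_perms {range d}. g (\<rho> \<circ> \<sigma>))"
    using sum.reindex_bij_betw[OF cyclic_perms_insert[OF assms(2)], of g]
    by (simp add: case_prod_unfold)
  also have "\<dots> = (\<Sum>\<rho>\<in>cyclic_perms \<P>. \<Sum>\<sigma>\<in>cyclic_perms {range d}. g (\<rho> \<circ> \<sigma>))"
    by (rule sum.cartesian_product[symmetric])
  also have "\<dots> = (\<Sum>\<rho>\<in>cyclic_perms \<P>. \<Sum>b\<in>UNIV. g (\<rho> \<circ> rot3 d b))"
    by (intro sum.cong refl sum.reindex_bij_betw[OF bij_betw_rot3[OF assms(1)], symmetric])
  finally show ?thesis .
qed


section \<open>Faces at a trivalent root\<close>

fun lab :: "idx \<Rightarrow> nat" where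
  "lab I0 = 0" | "lab I1 = 1" | "lab I2 = 2"

lemma lab_inject [simp]: "lab i = lab j \<longleftrightarrow> i = j"
  by (cases i; cases j) auto

definition touching :: "'v \<Rightarrow> 'v dart set" where
  "touching u = {(x, y, j). x = u \<or> y = u}"

definition root_face_count :: "('v, 'v dart) pre_digraph \<Rightarrow> 'v \<Rightarrow> ('v dart \<Rightarrow> 'v dart) \<Rightarrow> nat" where
  "root_face_count G u \<rho> = card {S \<in> faces G (dart_rev G) \<rho>. S \<inter> touching u \<noteq> {}}"

definition other_face_count :: "('v, 'v dart) pre_digraph \<Rightarrow> 'v \<Rightarrow> ('v dart \<Rightarrow> 'v dart) \<Rightarrow> nat" where
  "other_face_count G u \<rho> = card {S \<in> faces G (dart_rev G) \<rho>. S \<inter> touching u = {}}"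

fun root_dart :: "'v \<Rightarrow> (idx \<Rightarrow> 'v) \<Rightarrow> kind \<times> idx \<Rightarrow> 'v dart" where
  "root_dart u a (k, i) = (if k = RW then (u, a i, lab i) else (a i, u, lab i))"

text \<open>The invariant carried through the construction. The neighbours \<open>a i\<close> may
  coincide, as they do in the dipole; the labels keep the three root darts apart.\<close>

locale rooted_claw =
  fixes G :: "('v, 'v dart) pre_digraph" and u :: 'v and a :: "idx \<Rightarrow> 'v"
  assumes fin: "finite (verts G)" "finite (arcs G)"
    and tail: "tail G = fst" and head: "head G = fst \<circ> snd"
    and sym: "(x, y, j) \<in> arcs G \<Longrightarrow> (y, x, j) \<in> arcs G"
    and irrefl: "(x, y, j) \<in> arcs G \<Longrightarrow> x \<noteq> y"
    and vert: "(x, y, j) \<in> arcs G \<Longrightarrow> x \<in> verts G"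
    and root: "(u, x, j) \<in> arcs G \<longleftrightarrow> (\<exists>i. x = a i \<and> j = lab i)"
begin

lemma root_arc: "(u, a i, lab i) \<in> arcs G" "(a i, u, lab i) \<in> arcs G"
  using root sym by blast+

lemma root_neighbour: "a i \<noteq> u" "a i \<in> verts G" "u \<in> verts G"
  using root_arc irrefl vert by blast+

lemma dart_rev_arc: "(x, y, j) \<in> arcs G \<Longrightarrow> dart_rev G (x, y, j) = (y, x, j)"
  by (simp add: dart_rev_def)

lemma dart_rev_permutes: "dart_rev G permutes arcs G"
proof (rule bij_imp_permutes)
  show "bij_betw (dart_rev G) (arcs G) (arcs G)"
    by (rule bij_betw_byWitness[where f' = "dart_rev G"]) (auto simp: dart_rev_def sym)
qed (auto simp: dart_rev_def)

lemma face_perm_permutes: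
  "\<rho> \<in> rotation_systems G \<Longrightarrow> \<rho> \<circ> dart_rev G permutes arcs G"
  using dart_rev_permutes by (auto simp: rotation_systems_def intro: permutes_compose)

lemma finite_faces: "finite (faces G (dart_rev G) \<rho>)"
  unfolding faces_def using fin by simp

lemma card_faces: "card (faces G (dart_rev G) \<rho>) = root_face_count G u \<rho> + other_face_count G u \<rho>"
proof -
  have "faces G (dart_rev G) \<rho> = {S \<in> faces G (dart_rev G) \<rho>. S \<inter> touching u \<noteq> {}} \<union>
      {S \<in> faces G (dart_rev G) \<rho>. S \<inter> touching u = {}}"
    by blast
  then show ?thesis
    unfolding root_face_count_def other_face_count_def
    using finite_faces[of \<rho>] by (subst card_Un_disjoint[symmetric]) auto
qed

lemma face_subset:
  assumes "\<rho> \<in> rotation_systems G" "S \<in> faces G (dart_rev G) \<rho>"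
  shows "S \<subseteq> arcs G"
  using assms permutes_orbit_subset[OF face_perm_permutes[OF assms(1)]]
  unfolding faces_def by blast

lemma inj_root_dart: "inj_on (root_dart u a) root_codes"
  using root_neighbour by (auto simp: inj_on_def root_codes_def)

lemma root_dart_image: "root_dart u a ` root_codes = arcs G \<inter> touching u"
proof (intro subset_antisym subsetI)
  fix x assume "x \<in> root_dart u a ` root_codes"
  then show "x \<in> arcs G \<inter> touching u"
    using root_arc by (auto simp: root_codes_def touching_def)
next
  fix x assume "x \<in> arcs G \<inter> touching u"
  then obtain y z j where x: "x = (y, z, j)" "(y, z, j) \<in> arcs G" "y = u \<or> z = u"
    by (auto simp: touching_def)
  then have "(u, if y = u then z else y, j) \<in> arcs G" using sym[of y z j] by auto
  then obtain y j where "(u, y, j) \<in> arcs G" "x = (u, y, j) \<or> x = (y, u, j)"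
    using x that by (auto split: if_splits)
  then obtain i where "x = root_dart u a (RW, i) \<or> x = root_dart u a (WR, i)"
    using root by auto
  moreover have "(RW, i) \<in> root_codes" "(WR, i) \<in> root_codes"
    by (simp_all add: root_codes_def)
  ultimately show "x \<in> root_dart u a ` root_codes" by blast
qed

lemma out_arcs_root: "out_arcs G u = range (\<lambda>i. (u, a i, lab i))"
  using root by (auto simp: out_arcs_def tail)

lemma root_rotation:
  assumes "\<rho> \<in> rotation_systems G"
  obtains b where "\<And>i. \<rho> (u, a i, lab i) = (u, a (turn b i), lab (turn b i))"
proof -
  let ?d = "\<lambda>i. (u, a i, lab i)"
  have d: "inj ?d" by (auto intro: injI)
  have cyc: "cyclic_on \<rho> (range ?d)"
    using assms root_neighbour(3) unfolding rotation_systems_def out_arcs_root[symmetric]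
    using out_arcs_root by auto
  have "perm_restrict \<rho> (range ?d) \<in> cyclic_perms {range ?d}"
    using perm_restrict_permutes[OF cyc] cyc by (simp add: cyclic_perms_def cyclic_on_perm_restrict)
  then obtain b where b: "perm_restrict \<rho> (range ?d) = rot3 ?d b"
    using bij_betw_rot3[OF d] unfolding bij_betw_def by blast
  have "\<rho> (?d i) = ?d (turn b i)" for i
  proof -
    have "\<rho> (?d i) = perm_restrict \<rho> (range ?d) (?d i)" by (simp add: perm_restrict_def)
    then show ?thesis unfolding b rot3_apply[OF d] .
  qed
  then show thesis using that by blast
qed

text \<open>All that face tracing at the root retains of the rest of the graph is the bijection
  \<open>p\<close>, from the strand on which a face leaves the root to the strand on which it comes
  back.\<close>

lemma root_return_exists:
  assumes \<rho>: "\<rho> \<in> rotation_systems G"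
  obtains p b where "bij p"
    and "\<And>i. \<rho> (u, a i, lab i) = (u, a (turn b i), lab (turn b i))"
    and "first_return (\<rho> \<circ> dart_rev G) (arcs G) root_codes (root_dart u a) (root_return p b)"
proof -
  let ?\<phi> = "\<rho> \<circ> dart_rev G" and ?R = "root_dart u a ` root_codes"
  let ?d = "\<lambda>i. (u, a i, lab i)" and ?e = "\<lambda>i. (a i, u, lab i)"
  note \<phi> = face_perm_permutes[OF \<rho>]
  obtain b where b: "\<And>i. \<rho> (?d i) = ?d (turn b i)"
    by (rule root_rotation[OF \<rho>]) blast
  have bij_turn: "bij (turn b)"
    using bij_betw_rot3[of id] cyclic_perms_idx unfolding cyclic_perms_def
    by (auto dest: permutes_bij)
  have R: "?R = range ?d \<union> range ?e"
    by (auto simp: root_codes_def image_iff)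
  have \<phi>e: "?\<phi> (?e i) = ?d (turn b i)" for i
    using dart_rev_arc[OF root_arc(2)] b by simp
  have "\<exists>j. hits ?\<phi> ?R (?d i) (?e j)" for i
  proof -
    have "?d i \<in> ?R" unfolding R by blast
    then obtain y where y: "hits ?\<phi> ?R (?d i) y"
      using hits_exists[OF \<phi> fin(2)] by blast
    then obtain n where n: "0 < n" "(?\<phi> ^^ n) (?d i) = y" "y \<in> ?R"
        "\<And>m. 0 < m \<Longrightarrow> m < n \<Longrightarrow> (?\<phi> ^^ m) (?d i) \<notin> ?R"
      unfolding hits_def by blast
    \<comment> \<open>A face enters an outgoing root dart only from an incoming one, which would be
      an earlier visit to \<open>?R\<close>; so the first return is along an incoming dart.\<close>
    have "y \<noteq> ?d k" for k
    proof
      assume yk: "y = ?d k"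
      obtain k' where k': "turn b k' = k" using bij_turn by (metis bij_pointE)
      obtain m where m: "n = Suc m" using n(1) by (cases n) auto
      have "?\<phi> ((?\<phi> ^^ m) (?d i)) = ?\<phi> (?e k')"
        using n(2) unfolding m \<phi>e k' yk by simp
      then have em: "(?\<phi> ^^ m) (?d i) = ?e k'"
        using permutes_inj[OF \<phi>] by (rule injD[rotated])
      show False
      proof (cases "m = 0")
        case True
        then show False using em root_neighbour(1) by auto
      next
        case False
        then have "?e k' \<notin> ?R" using n(4)[of m] m em by simp
        then show False unfolding R by blast
      qed
    qed
    then obtain j where "y = ?e j" using n(3) unfolding R by blast
    then show ?thesis using y by blast
  qed
  then obtain p where p: "\<And>i. hits ?\<phi> ?R (?d i) (?e (p i))" by metis
  have "inj p"
  proof (rule injI)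
    fix i j assume "p i = p j"
    then have "?d i = ?d j"
      using hits_inj[OF permutes_inj[OF \<phi>], of ?R "?d i" "?e (p i)" "?d j"] p[of i] p[of j]
      unfolding R by auto
    then show "i = j" by simp
  qed
  then have "bij p" using finite_UNIV_inj_surj[OF finite_UNIV] by (simp add: bij_def)
  moreover have "first_return ?\<phi> (arcs G) root_codes (root_dart u a) (root_return p b)"
  proof
    show "?\<phi> permutes arcs G" "finite (arcs G)" by (fact \<phi> fin(2))+
    show "inj_on (root_dart u a) root_codes" by (fact inj_root_dart)
    show "?R \<subseteq> arcs G" using root_dart_image by blast
  next
    fix c :: "kind \<times> idx" assume c: "c \<in> root_codes"
    then obtain i where ci: "c = (RW, i) \<or> c = (WR, i)" by (auto simp: root_codes_def)
    then show "root_return p b c \<in> root_codes" by (auto simp: root_codes_def)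
    have "hits ?\<phi> ?R (?e i) (?d (turn b i))"
      by (rule hits_step, rule \<phi>e) (auto simp: R)
    then show "hits ?\<phi> ?R (root_dart u a c) (root_dart u a (root_return p b c))"
      using ci p[of i] by auto
  qed
  ultimately show thesis using that[OF _ b] by blast
qed

lemma root_face_count_eq:
  assumes \<rho>: "\<rho> \<in> rotation_systems G"
    and "first_return (\<rho> \<circ> dart_rev G) (arcs G) root_codes (root_dart u a) (root_return p b)"
  shows "root_face_count G u \<rho> = root_faces (root_return p b) root_codes"
proof -
  interpret first_return "\<rho> \<circ> dart_rev G" "arcs G" root_codes "root_dart u a" "root_return p b" by fact
  have "S \<inter> touching u = S \<inter> root_dart u a ` root_codes" if "S \<in> faces G (dart_rev G) \<rho>" for S
    using face_subset[OF \<rho> that] unfolding root_dart_image by blast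
  then have "root_face_count G u \<rho> =
      card {S \<in> faces G (dart_rev G) \<rho>. S \<inter> root_dart u a ` root_codes \<noteq> {}}"
    unfolding root_face_count_def by (metis (no_types, lifting))
  then show ?thesis
    using card_orbits_meeting[OF order_refl] unfolding faces_def root_faces_def by simp
qed

end


section \<open>Rotation systems of a claw extension\<close>

fun ext_dart :: "'v \<Rightarrow> (idx \<Rightarrow> 'v) \<Rightarrow> (idx \<Rightarrow> 'v) \<Rightarrow> 'v \<Rightarrow> kind \<times> idx \<Rightarrow> 'v dart" where
  "ext_dart u a w u' (WA, i) = (w i, a i, lab i)"
| "ext_dart u a w u' (AW, i) = (a i, w i, lab i)"
| "ext_dart u a w u' (WU, i) = (w i, u, lab i)"
| "ext_dart u a w u' (UW, i) = (u, w i, lab i)"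
| "ext_dart u a w u' (RW, i) = (u', w i, lab i)"
| "ext_dart u a w u' (WR, i) = (w i, u', lab i)"

locale claw_ext = rooted_claw G u a
  for G :: "('v, 'v dart) pre_digraph" and u :: 'v and a :: "idx \<Rightarrow> 'v" +
  fixes s :: "nat \<Rightarrow> 'v" and u' :: 'v
  assumes s_inj: "s (lab i) = s (lab j) \<Longrightarrow> i = j"
    and s_new: "s (lab i) \<notin> verts G"
    and u'_new: "u' \<notin> verts G" "u' \<noteq> s (lab i)"
begin

definition w :: "idx \<Rightarrow> 'v" where "w i = s (lab i)"

abbreviation G' :: "('v, 'v dart) pre_digraph" where "G' \<equiv> claw_extension G u s u'"

abbreviation xd :: "kind \<times> idx \<Rightarrow> 'v dart" where "xd \<equiv> ext_dart u a w u'"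

lemma vert2: "(x, y, j) \<in> arcs G \<Longrightarrow> y \<in> verts G"
  using sym vert by blast

lemma new [simp]: "w i = w j \<longleftrightarrow> i = j" "u' \<noteq> w i" "w i \<noteq> u'" "u' \<noteq> u" "u \<noteq> u'" "w i \<noteq> u" "u \<noteq> w i"
   "w i \<noteq> a j" "a j \<noteq> w i" "u' \<noteq> a j" "a j \<noteq> u'" "a j \<noteq> u" "u \<noteq> a j"
  using s_inj s_new[of i] s_new[of j] u'_new(1) u'_new(2)[of i] root_neighbour(1,2)[of i] root_neighbour(1,2)[of j] root_neighbour(3)
  by (auto simp: w_def)

lemma not_vert [simp]: "w i \<notin> verts G" "u' \<notin> verts G"
  using s_new u'_new by (auto simp: w_def)

lemma out_root: "out_arcs G u = {(u, a i, lab i) | i. True}"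
  unfolding out_arcs_root by auto

lemma in_root: "in_arcs G u \<union> out_arcs G u = arcs G \<inter> touching u"
  by (auto simp: in_arcs_def out_arcs_def tail head touching_def)

lemma root_arc_iff: "(u, x, j) \<in> arcs G \<longleftrightarrow> (\<exists>i. x = a i \<and> j = lab i)"
  "(x, u, j) \<in> arcs G \<longleftrightarrow> (\<exists>i. x = a i \<and> j = lab i)"
  using root sym by blast+

definition old_arcs :: "'v dart set" where "old_arcs = arcs G - touching u"

lemma range_xd: "range xd = (\<Union>i. {(w i, a i, lab i), (a i, w i, lab i), (w i, u, lab i),
    (u, w i, lab i), (u', w i, lab i), (w i, u', lab i)})"
proof (intro subset_antisym subsetI)
  fix x assume "x \<in> range xd"
  then obtain k i where "x = xd (k, i)" by auto
  then show "x \<in> (\<Union>i. {(w i, a i, lab i), (a i, w i, lab i), (w i, u, lab i),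
    (u, w i, lab i), (u', w i, lab i), (w i, u', lab i)})"
    by (cases k) auto
next
  fix x assume "x \<in> (\<Union>i. {(w i, a i, lab i), (a i, w i, lab i), (w i, u, lab i),
    (u, w i, lab i), (u', w i, lab i), (w i, u', lab i)})"
  then obtain i where "x \<in> xd ` {(WA, i), (AW, i), (WU, i), (UW, i), (RW, i), (WR, i)}" by auto
  then show "x \<in> range xd" by blast
qed

lemma inj_xd: "inj xd"
proof (rule injI)
  fix x y assume "xd x = xd y"
  moreover obtain k i k' i' where "x = (k, i)" "y = (k', i')" by fastforce
  ultimately show "x = y" by (cases k; cases k') auto
qed

lemma arcs_ext: "arcs G' = old_arcs \<union> range xd"
proof -
  have "arcs G' = (arcs G - (out_arcs G u \<union> in_arcs G u)) \<union>
      (\<Union>i. edge u (w i) (lab i) \<union> edge (w i) (a i) (lab i) \<union> edge (w i) u' (lab i))"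
    unfolding claw_extension_def dart_graph_def by (auto simp: out_root w_def)
  also have "arcs G - (out_arcs G u \<union> in_arcs G u) = old_arcs"
    using in_root unfolding old_arcs_def by blast
  finally show ?thesis unfolding range_xd edge_def by auto
qed

lemma verts_ext: "verts G' = verts G \<union> range w \<union> {u'}"
  unfolding claw_extension_def dart_graph_def using root by (auto simp: w_def)

lemma tail_ext: "tail G' = fst" "head G' = fst \<circ> snd"
  by (simp_all add: claw_extension_def dart_graph_def)

lemma old_arcs_verts:
  "(x, y, j) \<in> old_arcs \<Longrightarrow> x \<in> verts G \<and> y \<in> verts G \<and> x \<noteq> u \<and> y \<noteq> u \<and> x \<noteq> y \<and> (y, x, j) \<in> old_arcs"
  using vert vert2 sym irrefl unfolding old_arcs_def touching_def by blast

lemma ext_rooted_claw: "rooted_claw G' u' w"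
proof
  show "finite (verts G')" "finite (arcs G')"
    using fin by (simp_all add: verts_ext arcs_ext old_arcs_def)
  show "tail G' = fst" "head G' = fst \<circ> snd" by (rule tail_ext)+
  fix x y j
  show "(u', x, j) \<in> arcs G' \<longleftrightarrow> (\<exists>i. x = w i \<and> j = lab i)"
    using old_arcs_verts[of u' x j] unfolding arcs_ext range_xd by auto
  assume "(x, y, j) \<in> arcs G'"
  then show "(y, x, j) \<in> arcs G'" "x \<noteq> y" "x \<in> verts G'"
    using old_arcs_verts[of x y j] root_neighbour unfolding arcs_ext range_xd verts_ext by auto
qed

sublocale ext: rooted_claw G' u' w by (rule ext_rooted_claw)

text \<open>Sends an old dart to the dart of \<open>G'\<close> that takes its place in the rotation
  at the same vertex, so it carries stars to stars. A dart at \<open>u\<close> is cut to its initial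
  half, which ends at the subdividing vertex; \<open>h\<close> therefore does not commute with
  reversal there.\<close>

fun h :: "'v dart \<Rightarrow> 'v dart" where
  "h (x, y, j) = (if y = u then (x, s j, j) else if x = u then (u, s j, j) else (x, y, j))"

lemma h_old: "x \<in> old_arcs \<Longrightarrow> h x = x"
  using old_arcs_verts by (cases x) auto

lemma h_root: "h (u, a i, lab i) = (u, w i, lab i)" "h (a i, u, lab i) = (a i, w i, lab i)"
  by (simp_all add: w_def)

lemma arcs_cases:
  assumes "x \<in> arcs G"
  obtains "x \<in> old_arcs" | i where "x = (u, a i, lab i)" | i where "x = (a i, u, lab i)"
proof -
  obtain y z j where x: "x = (y, z, j)" by (cases x)
  consider "y = u" | "z = u" | "y \<noteq> u" "z \<noteq> u" by blast
  then show thesis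
  proof cases
    case 1
    then obtain i where "z = a i" "j = lab i" using assms root_arc_iff(1)[of z j] unfolding x by blast
    then show thesis using that(2)[of i] 1 unfolding x by simp
  next
    case 2
    then obtain i where "y = a i" "j = lab i" using assms root_arc_iff(2)[of y j] unfolding x by blast
    then show thesis using that(3)[of i] 2 unfolding x by simp
  next
    case 3
    then show thesis using that(1) assms unfolding x old_arcs_def touching_def by simp
  qed
qed

lemma fst_h: "x \<in> arcs G \<Longrightarrow> fst (h x) = fst x"
  by (cases x) auto

lemma inj_h: "inj_on h (arcs G)"
proof (rule inj_onI)
  fix x y assume "x \<in> arcs G" "y \<in> arcs G" "h x = h y"
  then show "x = y"
    by (elim arcs_cases) (auto simp: h_root h_old dest: old_arcs_verts simp del: h.simps)
qed

lemma out_arcs_ext_old: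
  assumes v: "v \<in> verts G" shows "out_arcs G' v = h ` out_arcs G v"
proof (intro subset_antisym subsetI)
  fix x assume "x \<in> h ` out_arcs G v"
  then obtain y where y: "y \<in> arcs G" "fst y = v" "x = h y" by (auto simp: out_arcs_def tail)
  moreover have "h y \<in> arcs G'"
    using y(1) by (elim arcs_cases) (auto simp: h_root h_old arcs_ext range_xd simp del: h.simps)
  ultimately show "x \<in> out_arcs G' v" using fst_h by (simp add: out_arcs_def tail_ext)
next
  fix x assume "x \<in> out_arcs G' v"
  then have x: "x \<in> arcs G'" "fst x = v" by (auto simp: out_arcs_def tail_ext)
  then consider "x \<in> old_arcs" | i where "x = (a i, w i, lab i)" | i where "x = (u, w i, lab i)"
    using v unfolding arcs_ext range_xd by auto
  then show "x \<in> h ` out_arcs G v"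
  proof cases
    case 1
    then show ?thesis using x h_old[OF 1] by (intro image_eqI[of _ _ x]) (auto simp: out_arcs_def tail old_arcs_def)
  next
    case (2 i)
    then show ?thesis using x root_arc h_root(2)[of i]
      by (intro image_eqI[of _ _ "(a i, u, lab i)"]) (auto simp: out_arcs_def tail simp del: h.simps)
  next
    case (3 i)
    then show ?thesis using x root_arc h_root(1)[of i]
      by (intro image_eqI[of _ _ "(u, a i, lab i)"]) (auto simp: out_arcs_def tail simp del: h.simps)
  qed
qed

text \<open>The order new root, old neighbour, old root makes \<open>turn True\<close> the rotation
  \<open>(R A U)\<close> that \<open>claw_return\<close> presupposes.\<close>

definition sub_darts :: "idx \<Rightarrow> idx \<Rightarrow> 'v dart" where
  "sub_darts i = tri ((w i, u', lab i), (w i, a i, lab i), (w i, u, lab i))"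

definition new_root_darts :: "idx \<Rightarrow> 'v dart" where
  "new_root_darts i = (u', w i, lab i)"

lemma inj_sub_darts: "inj (sub_darts i)"
proof (rule injI)
  fix j k assume "sub_darts i j = sub_darts i k"
  then show "j = k" unfolding sub_darts_def by (cases j; cases k) auto
qed

lemma inj_new_root_darts: "inj new_root_darts"
  by (auto simp: new_root_darts_def intro: injI)

lemma out_arcs_sub: "out_arcs G' (w i) = range (sub_darts i)"
proof -
  have no: "(w i, y, j) \<notin> old_arcs" for y j
    using old_arcs_verts[of "w i" y j] by auto
  have "range (sub_darts i) = {(w i, u', lab i), (w i, a i, lab i), (w i, u, lab i)}"
    by (simp add: UNIV_idx sub_darts_def)
  moreover have "out_arcs G' (w i) = {(w i, u', lab i), (w i, a i, lab i), (w i, u, lab i)}"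
    unfolding out_arcs_def tail_ext arcs_ext range_xd by (auto simp: no)
  ultimately show ?thesis by simp
qed

lemma out_arcs_new_root: "out_arcs G' u' = range new_root_darts"
  unfolding ext.out_arcs_root new_root_darts_def ..

lemma rotation_systems_ext:
  "rotation_systems G' = cyclic_perms (insert (range new_root_darts) (insert (range (sub_darts I2))
     (insert (range (sub_darts I1)) (insert (range (sub_darts I0))
       ((`) h ` (out_arcs G ` verts G - {{}}))))))"
proof -
  have Diff: "A = B \<union> C \<union> {D} \<Longrightarrow> {} \<notin> C \<Longrightarrow> D \<noteq> {} \<Longrightarrow> A - {{}} = (B - {{}}) \<union> C \<union> {D}"
    for A B C :: "'v dart set set" and D
    by blast
  have "out_arcs G' ` verts G' =
      out_arcs G' ` verts G \<union> range (\<lambda>i. range (sub_darts i)) \<union> {range new_root_darts}"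
    by (simp add: verts_ext image_Un image_image out_arcs_sub out_arcs_new_root)
  moreover have "{} \<notin> range (\<lambda>i. range (sub_darts i))" "range new_root_darts \<noteq> {}" by auto
  ultimately have "out_arcs G' ` verts G' - {{}} =
      (out_arcs G' ` verts G - {{}}) \<union> range (\<lambda>i. range (sub_darts i)) \<union> {range new_root_darts}"
    by (rule Diff)
  also have "out_arcs G' ` verts G - {{}} = (`) h ` (out_arcs G ` verts G - {{}})"
  proof -
    have "out_arcs G' ` verts G = (`) h ` out_arcs G ` verts G"
      by (simp add: out_arcs_ext_old image_image)
    then show ?thesis by auto
  qed
  also have "range (\<lambda>i. range (sub_darts i)) = {range (sub_darts I0), range (sub_darts I1), range (sub_darts I2)}"
    by (simp add: UNIV_idx)
  finally have "out_arcs G' ` verts G' - {{}} = insert (range new_root_darts) (insert (range (sub_darts I2))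
     (insert (range (sub_darts I1)) (insert (range (sub_darts I0))
       ((`) h ` (out_arcs G ` verts G - {{}})))))"
    by auto
  moreover have "rotation_systems G' = cyclic_perms (out_arcs G' ` verts G' - {{}})"
    by (rule rotation_systems_eq) (use ext.vert in \<open>auto simp: tail_ext\<close>)
  ultimately show ?thesis by simp
qed

definition ext_rot :: "('v dart \<Rightarrow> 'v dart) \<Rightarrow> bool \<Rightarrow> bool \<Rightarrow> bool \<Rightarrow> bool \<Rightarrow> 'v dart \<Rightarrow> 'v dart" where
  "ext_rot \<rho> t0 t1 t2 b = map_permutation (arcs G) h \<rho> \<circ> rot3 (sub_darts I0) t0 \<circ>
     rot3 (sub_darts I1) t1 \<circ> rot3 (sub_darts I2) t2 \<circ> rot3 new_root_darts b"

lemma fst_sub_darts [simp]: "fst (sub_darts i j) = w i"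
  by (cases j) (simp_all add: sub_darts_def)

lemma fst_new_root_darts [simp]: "fst (new_root_darts i) = u'"
  by (simp add: new_root_darts_def)

text \<open>A rotation system of \<open>G'\<close> amounts to one of \<open>G\<close>, transported
  by \<open>h\<close>, and four binary choices: the three subdividing vertices and the new root are
  inserted star by star.\<close>

lemma sum_rotation_systems_ext:
  "(\<Sum>\<rho>\<in>rotation_systems G'. g \<rho>) = (\<Sum>\<rho>\<in>rotation_systems G.
     \<Sum>t0\<in>UNIV. \<Sum>t1\<in>UNIV. \<Sum>t2\<in>UNIV. \<Sum>b\<in>UNIV. g (ext_rot \<rho> t0 t1 t2 b))"
proof -
  let ?P = "out_arcs G ` verts G - {{}}"
  have Un: "\<Union>?P = arcs G"
  proof (intro subset_antisym subsetI)
    fix x assume "x \<in> arcs G"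
    moreover from this have "fst x \<in> verts G" using vert by (cases x) auto
    moreover from calculation have "x \<in> out_arcs G (fst x)" by (simp add: out_arcs_def tail)
    ultimately show "x \<in> \<Union>?P" by blast
  qed (auto simp: out_arcs_def)
  have RS: "rotation_systems G = cyclic_perms ?P"
    by (rule rotation_systems_eq) (use vert in \<open>auto simp: tail\<close>)
  define Q where "Q = (`) h ` ?P"
  have Q: "fst x \<in> verts G" if "X \<in> Q" "x \<in> X" for x X
    using that vert fst_h unfolding Q_def by (auto simp: out_arcs_def tail)
  have fst_Q: "w i \<notin> fst ` \<Union>Q" "u' \<notin> fst ` \<Union>Q" for i
  proof -
    have "fst ` \<Union>Q \<subseteq> verts G" using Q by blast
    then show "w i \<notin> fst ` \<Union>Q" "u' \<notin> fst ` \<Union>Q" using not_vert by blast+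
  qed
  have fst_range: "fst ` range (sub_darts i) = {w i}" "fst ` range new_root_darts = {u'}" for i
    by (simp_all add: image_image)
  \<comment> \<open>Stars are kept apart by the vertex at which their darts start.\<close>
  have disj: "A \<inter> B = {}" if "fst ` A = {v}" "v \<notin> fst ` B" for A B :: "'v dart set" and v
  proof (rule ccontr)
    assume "A \<inter> B \<noteq> {}"
    then obtain x where "x \<in> A" "x \<in> B" by blast
    then have "fst x \<in> fst ` A" "fst x \<in> fst ` B" by simp_all
    then show False using that by simp
  qed
  have d0: "range (sub_darts I0) \<inter> \<Union>Q = {}"
    by (rule disj[of _ "w I0"]) (simp_all only: fst_range fst_Q not_False_eq_True)
  have d1: "range (sub_darts I1) \<inter> \<Union>(insert (range (sub_darts I0)) Q) = {}"
    by (rule disj[of _ "w I1"]) (simp_all add: fst_range fst_Q image_Un del: image_Union)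
  have d2: "range (sub_darts I2) \<inter> \<Union>(insert (range (sub_darts I1)) (insert (range (sub_darts I0)) Q)) = {}"
    by (rule disj[of _ "w I2"]) (simp_all add: fst_range fst_Q image_Un del: image_Union)
  have d3: "range new_root_darts \<inter> \<Union>(insert (range (sub_darts I2)) (insert (range (sub_darts I1))
      (insert (range (sub_darts I0)) Q))) = {}"
    by (rule disj[of _ "u'"]) (simp_all add: fst_range fst_Q image_Un del: image_Union)
  have "(\<Sum>\<rho>\<in>cyclic_perms Q. g \<rho>) =
      (\<Sum>\<rho>\<in>cyclic_perms ?P. g (map_permutation (arcs G) h \<rho>))" for g :: "('v dart \<Rightarrow> 'v dart) \<Rightarrow> _"
    using sum.reindex_bij_betw[OF cyclic_perms_image[of h ?P]] inj_h unfolding Un Q_def by metis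
  then show ?thesis
    unfolding rotation_systems_ext RS ext_rot_def Q_def[symmetric]
      sum_cyclic_perms_insert[OF inj_new_root_darts d3] sum_cyclic_perms_insert[OF inj_sub_darts d2]
      sum_cyclic_perms_insert[OF inj_sub_darts d1] sum_cyclic_perms_insert[OF inj_sub_darts d0]
    by simp
qed

end


section \<open>Faces of a claw extension\<close>

context claw_ext
begin

lemma rot_sub_other: "fst x \<noteq> w i \<Longrightarrow> rot3 (sub_darts i) t x = x"
  by (rule rot3_outside) auto

lemma rot_new_root_other: "fst x \<noteq> u' \<Longrightarrow> rot3 new_root_darts t x = x"
  by (rule rot3_outside) auto

lemma map_rot_other:
  assumes "fst x \<notin> verts G" shows "map_permutation (arcs G) h \<rho> x = x"
proof -
  have "x \<notin> h ` arcs G" using assms vert fst_h by fastforce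
  then show ?thesis by (simp add: map_permutation_def restrict_id_def)
qed

lemma ext_rot_old:
  assumes x: "x \<in> arcs G"
  shows "ext_rot \<rho> t0 t1 t2 b (h x) = h (\<rho> x)"
proof -
  have "fst (h x) \<in> verts G" using x vert by (cases x) auto
  then have "fst (h x) \<noteq> w i" "fst (h x) \<noteq> u'" for i using not_vert by metis+
  then show ?thesis
    unfolding ext_rot_def comp_apply
    by (simp only: rot_sub_other rot_new_root_other not_False_eq_True map_permutation_apply[OF inj_h x])
qed

lemma ext_rot_sub:
  "ext_rot \<rho> t0 t1 t2 b (sub_darts i j) = sub_darts i (turn (tri (t0, t1, t2) i) j)"
  unfolding ext_rot_def comp_apply
  by (cases i) (simp_all add: rot_sub_other rot_new_root_other map_rot_other rot3_apply[OF inj_sub_darts])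

lemma ext_rot_new_root:
  "ext_rot \<rho> t0 t1 t2 b (new_root_darts i) = new_root_darts (turn b i)"
  unfolding ext_rot_def comp_apply
  by (simp add: rot_sub_other map_rot_other rot3_apply[OF inj_new_root_darts])

lemma finite_rotation_systems: "finite (rotation_systems G)"
  by (rule finite_subset[OF _ finite_permutations[OF fin(2)]]) (auto simp: rotation_systems_def)

lemma ext_rot_in:
  assumes "\<rho> \<in> rotation_systems G"
  shows "ext_rot \<rho> t0 t1 t2 b \<in> rotation_systems G'"
proof -
  \<comment> \<open>sum the indicator of non-membership with the preceding reindexing\<close>
  let ?g = "\<lambda>\<tau>. if \<tau> \<in> rotation_systems G' then 0 else 1 :: nat"
  have "(\<Sum>\<rho>\<in>rotation_systems G. \<Sum>t0\<in>UNIV. \<Sum>t1\<in>UNIV. \<Sum>t2\<in>UNIV. \<Sum>b\<in>UNIV.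
      ?g (ext_rot \<rho> t0 t1 t2 b)) = 0"
    by (rule trans[OF sum_rotation_systems_ext[of ?g, symmetric]]) simp
  then have "?g (ext_rot \<rho> t0 t1 t2 b) = 0"
    using assms finite_rotation_systems by (simp only: sum_eq_0_iff finite_UNIV) blast
  then show ?thesis by (simp split: if_splits)
qed

lemma rev_ext:
  "dart_rev G' (xd (WA, i)) = h (a i, u, lab i)"
  "dart_rev G' (xd (AW, i)) = sub_darts i I1"
  "dart_rev G' (xd (WU, i)) = h (u, a i, lab i)"
  "dart_rev G' (xd (UW, i)) = sub_darts i I2"
  "dart_rev G' (xd (RW, i)) = sub_darts i I0"
  "dart_rev G' (xd (WR, i)) = new_root_darts i"
proof -
  have xd: "xd c \<in> arcs G'" for c unfolding arcs_ext by blast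
  show "dart_rev G' (xd (WA, i)) = h (a i, u, lab i)"
    using ext.dart_rev_arc xd[of "(WA, i)"] unfolding h_root by simp
  show "dart_rev G' (xd (AW, i)) = sub_darts i I1"
    using ext.dart_rev_arc xd[of "(AW, i)"] unfolding sub_darts_def by simp
  show "dart_rev G' (xd (WU, i)) = h (u, a i, lab i)"
    using ext.dart_rev_arc xd[of "(WU, i)"] unfolding h_root by simp
  show "dart_rev G' (xd (UW, i)) = sub_darts i I2"
    using ext.dart_rev_arc xd[of "(UW, i)"] unfolding sub_darts_def by simp
  show "dart_rev G' (xd (RW, i)) = sub_darts i I0"
    using ext.dart_rev_arc xd[of "(RW, i)"] unfolding sub_darts_def by simp
  show "dart_rev G' (xd (WR, i)) = new_root_darts i"
    using ext.dart_rev_arc xd[of "(WR, i)"] unfolding new_root_darts_def by simp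
qed

lemma rev_old:
  assumes "x \<in> old_arcs"
  shows "dart_rev G' x = h (dart_rev G x)" "dart_rev G x \<in> old_arcs"
proof -
  obtain y z j where x: "x = (y, z, j)" by (cases x)
  have "(y, z, j) \<in> arcs G'" "(y, z, j) \<in> arcs G" "(z, y, j) \<in> old_arcs"
    using assms old_arcs_verts[of y z j] unfolding x arcs_ext by (auto simp: old_arcs_def)
  then show "dart_rev G' x = h (dart_rev G x)" "dart_rev G x \<in> old_arcs"
    unfolding x by (simp_all only: ext.dart_rev_arc dart_rev_arc h_old)
qed

lemma old_arcs_not_xd: "x \<in> old_arcs \<Longrightarrow> x \<notin> range xd"
  using old_arcs_verts unfolding range_xd by fastforce

context
  fixes \<rho> :: "'v dart \<Rightarrow> 'v dart" and p :: "idx \<Rightarrow> idx" and b t0 t1 t2 b' :: bool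
  assumes \<rho>: "\<rho> \<in> rotation_systems G"
    and root_rot: "\<And>i. \<rho> (u, a i, lab i) = (u, a (turn b i), lab (turn b i))"
    and fr: "first_return (\<rho> \<circ> dart_rev G) (arcs G) root_codes (root_dart u a) (root_return p b)"
begin

interpretation old: first_return "\<rho> \<circ> dart_rev G" "arcs G" root_codes "root_dart u a" "root_return p b"
  by (rule fr)

abbreviation (input) "\<phi> \<equiv> \<rho> \<circ> dart_rev G"
abbreviation (input) "\<phi>' \<equiv> ext_rot \<rho> t0 t1 t2 b' \<circ> dart_rev G'"

lemma face_step_old: "x \<in> old_arcs \<Longrightarrow> \<phi>' x = h (\<phi> x)"
  using rev_old ext_rot_old by (simp add: old_arcs_def)

text \<open>A face that reaches the old neighbour from the subdividing vertex turns exactly as it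
  did when it came from \<open>u\<close> before the subdivision.\<close>

lemma face_step_WA: "\<phi>' (xd (WA, i)) = h (\<phi> (u, a i, lab i))"
  using rev_ext(1)[of i] ext_rot_old[OF root_arc(2)] dart_rev_arc[OF root_arc(1)] by simp

lemma face_step_new:
  assumes "k \<noteq> WA"
  shows "\<phi>' (xd (k, i)) = xd (claw_return p b (tri (t0, t1, t2)) b' (k, i))"
proof (cases k)
  case AW
  then show ?thesis by (simp only: comp_apply rev_ext ext_rot_sub) (auto simp: turn_def sub_darts_def)
next
  case WU
  have "\<phi>' (xd (WU, i)) = h (\<rho> (u, a i, lab i))"
    by (simp only: comp_apply rev_ext ext_rot_old[OF root_arc(1)])
  then show ?thesis unfolding WU root_rot h_root by simp
next
  case UW
  then show ?thesis by (simp only: comp_apply rev_ext ext_rot_sub) (auto simp: turn_def sub_darts_def)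
next
  case RW
  then show ?thesis by (simp only: comp_apply rev_ext ext_rot_sub) (auto simp: turn_def sub_darts_def)
next
  case WR
  then show ?thesis
    by (simp only: comp_apply rev_ext ext_rot_new_root) (auto simp: new_root_darts_def)
qed (use assms in simp)

text \<open>From \<open>WA\<close> the new face follows the old one step by step while the latter
  stays on old arcs. The old face first returns to the root along an incoming dart, whose image
  under \<open>h\<close> is coded by \<open>AW\<close>.\<close>

lemma hits_WA: "hits \<phi>' (range xd) (xd (WA, i)) (xd (AW, p i))"
proof -
  have "hits \<phi> (arcs G \<inter> touching u) (u, a i, lab i) (a (p i), u, lab (p i))"
    using old.hit[of "(RW, i)"] unfolding root_dart_image by (simp add: root_codes_def)
  then obtain n where n: "0 < n" "(\<phi> ^^ n) (u, a i, lab i) = (a (p i), u, lab (p i))"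
      "\<And>m. 0 < m \<Longrightarrow> m < n \<Longrightarrow> (\<phi> ^^ m) (u, a i, lab i) \<notin> arcs G \<inter> touching u"
    unfolding hits_def by blast
  have old: "(\<phi> ^^ m) (u, a i, lab i) \<in> old_arcs" if "0 < m" "m < n" for m
  proof -
    have "(\<phi> ^^ m) (u, a i, lab i) \<in> arcs G"
      by (induction m) (use root_arc(1) permutes_in_image[OF face_perm_permutes[OF \<rho>]] in auto)
    then show ?thesis using n(3)[OF that] unfolding old_arcs_def by blast
  qed
  have step: "(\<phi>' ^^ m) (xd (WA, i)) = h ((\<phi> ^^ m) (u, a i, lab i))" if "0 < m" "m \<le> n" for m
    using that
  proof (induction m)
    case (Suc m)
    show ?case
    proof (cases "m = 0")
      case True
      then show ?thesis using face_step_WA by simp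
    next
      case False
      then have m: "(\<phi> ^^ m) (u, a i, lab i) \<in> old_arcs" using Suc.prems old by simp
      have IH: "(\<phi>' ^^ m) (xd (WA, i)) = h ((\<phi> ^^ m) (u, a i, lab i))"
        by (rule Suc.IH) (use Suc.prems False in linarith)+
      have "(\<phi>' ^^ Suc m) (xd (WA, i)) = \<phi>' ((\<phi>' ^^ m) (xd (WA, i)))"
        unfolding funpow.simps(2) by (rule comp_apply)
      also have "\<dots> = h (\<phi> ((\<phi> ^^ m) (u, a i, lab i)))"
        unfolding IH h_old[OF m] by (rule face_step_old[OF m])
      also have "\<phi> ((\<phi> ^^ m) (u, a i, lab i)) = (\<phi> ^^ Suc m) (u, a i, lab i)"
        unfolding funpow.simps(2) by (rule comp_apply[symmetric])
      finally show ?thesis .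
    qed
  qed simp
  have "(\<phi>' ^^ n) (xd (WA, i)) = xd (AW, p i)"
    using step[of n] n(1,2) h_root(2) by simp
  moreover have "(\<phi>' ^^ m) (xd (WA, i)) \<notin> range xd" if "0 < m" "m < n" for m
    using step[of m] old[OF that] that h_old old_arcs_not_xd by simp
  ultimately show ?thesis unfolding hits_def using n(1) by blast
qed

lemma first_return_ext:
  "first_return \<phi>' (arcs G') UNIV xd (claw_return p b (tri (t0, t1, t2)) b')"
proof
  show "\<phi>' permutes arcs G'" by (rule ext.face_perm_permutes[OF ext_rot_in[OF \<rho>]])
  show "finite (arcs G')" by (rule ext.fin)
  show "inj xd" by (rule inj_xd)
  show "range xd \<subseteq> arcs G'" unfolding arcs_ext by blast
  fix c :: "kind \<times> idx"
  obtain k i where c: "c = (k, i)" by (cases c)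
  show "hits \<phi>' (range xd) (xd c) (xd (claw_return p b (tri (t0, t1, t2)) b' c))"
  proof (cases "k = WA")
    case True
    then show ?thesis using hits_WA unfolding c by simp
  next
    case False
    show ?thesis unfolding c by (rule hits_step, rule face_step_new[OF False]) blast
  qed
qed simp

text \<open>The two face permutations agree on an old arc unless the next dart lies at the old root,
  so an orbit among old arcs is the same set for both.\<close>

lemma closed_faces_ext:
  "{S \<in> orbit \<phi>' ` arcs G'. S \<inter> range xd = {}} = {S \<in> orbit \<phi> ` arcs G. S \<inter> (arcs G \<inter> touching u) = {}}"
proof -
  interpret new: first_return \<phi>' "arcs G'" UNIV xd "claw_return p b (tri (t0, t1, t2)) b'"
    by (rule first_return_ext)
  have agree: "\<phi>' x = \<phi> x" if "x \<in> old_arcs" "\<phi>' x \<notin> range xd \<or> \<phi> x \<notin> touching u" for x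
  proof -
    have "\<phi> x \<in> arcs G"
      using permutes_in_image[OF face_perm_permutes[OF \<rho>]] that(1) by (simp add: old_arcs_def)
    then have "\<phi> x \<in> old_arcs"
    proof (cases rule: arcs_cases)
      case (2 i)
      then have "\<phi>' x = xd (UW, i)" "\<phi> x \<in> touching u"
        using face_step_old[OF that(1)] h_root(1)[of i] by (auto simp: touching_def)
      then show ?thesis using that(2) by blast
    next
      case (3 i)
      then have "\<phi>' x = xd (AW, i)" "\<phi> x \<in> touching u"
        using face_step_old[OF that(1)] h_root(2)[of i] by (auto simp: touching_def)
      then show ?thesis using that(2) by blast
    qed
    then show ?thesis using face_step_old[OF that(1)] h_old by simp
  qed
  show ?thesis
  proof (intro subset_antisym subsetI)
    fix S assume "S \<in> {S \<in> orbit \<phi>' ` arcs G'. S \<inter> range xd = {}}"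
    then obtain x where x: "x \<in> arcs G'" "S = orbit \<phi>' x" "S \<inter> range xd = {}" by blast
    have xS: "x \<in> S" using x(2) permutation_self_in_orbit[OF new.perm] by simp
    have S: "S \<subseteq> old_arcs"
      using permutes_orbit_subset[OF new.f(1) x(1)] x(2,3) unfolding arcs_ext by blast
    have "orbit \<phi> x = orbit \<phi>' x"
    proof (rule orbit_cong)
      fix y assume y: "y \<in> orbit \<phi>' x"
      then have "\<phi>' y \<in> orbit \<phi>' x" by (rule orbit.step)
      then show "\<phi> y = \<phi>' y" using agree[of y] y S x(2,3) by fastforce
    qed (use xS x(2) in simp)
    then show "S \<in> {S \<in> orbit \<phi> ` arcs G. S \<inter> (arcs G \<inter> touching u) = {}}"
      using S xS x(2) unfolding old_arcs_def by blast
  next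
    fix S assume "S \<in> {S \<in> orbit \<phi> ` arcs G. S \<inter> (arcs G \<inter> touching u) = {}}"
    then obtain x where x: "x \<in> arcs G" "S = orbit \<phi> x" "S \<inter> (arcs G \<inter> touching u) = {}" by blast
    have xS: "x \<in> S" using x(2) permutation_self_in_orbit[OF old.perm] by simp
    have S: "S \<subseteq> old_arcs"
      using permutes_orbit_subset[OF old.f(1) x(1)] x(2,3) unfolding old_arcs_def by blast
    have "orbit \<phi>' x = orbit \<phi> x"
    proof (rule orbit_cong)
      fix y assume y: "y \<in> orbit \<phi> x"
      then have "\<phi> y \<in> orbit \<phi> x" by (rule orbit.step)
      then show "\<phi>' y = \<phi> y" using agree[of y] y S x(2) unfolding old_arcs_def by blast
    qed (use xS x(2) in simp)
    then show "S \<in> {S \<in> orbit \<phi>' ` arcs G'. S \<inter> range xd = {}}"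
      using S xS x(2) old_arcs_not_xd unfolding arcs_ext by blast
  qed
qed

lemma xd_root_codes: "xd ` root_codes = arcs G' \<inter> touching u'"
proof -
  have "xd ` root_codes = root_dart u' w ` root_codes"
    by (rule image_cong) (auto simp: root_codes_def)
  then show ?thesis using ext.root_dart_image by simp
qed

lemma ext_face_counts:
  "root_face_count G' u' (ext_rot \<rho> t0 t1 t2 b') =
     root_faces (claw_return p b (tri (t0, t1, t2)) b') UNIV"
  "other_face_count G' u' (ext_rot \<rho> t0 t1 t2 b') = other_face_count G u \<rho> +
     other_faces (claw_return p b (tri (t0, t1, t2)) b') UNIV"
proof -
  interpret new: first_return \<phi>' "arcs G'" UNIV xd "claw_return p b (tri (t0, t1, t2)) b'"
    by (rule first_return_ext)
  have new: "S \<inter> touching u' = S \<inter> xd ` root_codes" if "S \<in> orbit \<phi>' ` arcs G'" for S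
    using ext.face_subset[OF ext_rot_in[OF \<rho>]] that unfolding xd_root_codes faces_def by blast
  have old: "S \<inter> touching u = S \<inter> (arcs G \<inter> touching u)" if "S \<in> orbit \<phi> ` arcs G" for S
    using face_subset[OF \<rho>] that unfolding faces_def by blast
  have "{S \<in> orbit \<phi>' ` arcs G'. S \<inter> touching u' \<noteq> {}} = {S \<in> orbit \<phi>' ` arcs G'. S \<inter> xd ` root_codes \<noteq> {}}"
    "{S \<in> orbit \<phi>' ` arcs G'. S \<inter> touching u' = {}} = {S \<in> orbit \<phi>' ` arcs G'. S \<inter> xd ` root_codes = {}}"
    "{S \<in> orbit \<phi> ` arcs G. S \<inter> touching u = {}} = {S \<in> orbit \<phi> ` arcs G. S \<inter> (arcs G \<inter> touching u) = {}}"
    using new old by (metis (no_types, lifting))+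
  then show
    "root_face_count G' u' (ext_rot \<rho> t0 t1 t2 b') =
      root_faces (claw_return p b (tri (t0, t1, t2)) b') UNIV"
    "other_face_count G' u' (ext_rot \<rho> t0 t1 t2 b') = other_face_count G u \<rho> +
      other_faces (claw_return p b (tri (t0, t1, t2)) b') UNIV"
    using new.card_orbits_meeting[of root_codes] new.card_orbits_avoiding[of root_codes] closed_faces_ext
    unfolding root_face_count_def other_face_count_def root_faces_def other_faces_def faces_def
    by simp_all
qed

end

lemma root_face_count_range:
  assumes "\<rho> \<in> rotation_systems G"
  shows "root_face_count G u \<rho> \<in> {1, 2, 3}"
proof -
  obtain p b where pb: "bij p" "first_return (\<rho> \<circ> dart_rev G) (arcs G) root_codes (root_dart u a) (root_return p b)"
    using root_return_exists[OF assms] by metis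
  show ?thesis
    unfolding root_face_count_eq[OF assms pb(2)] by (rule sum_claw_returns(1)[OF pb(1)])
qed

text \<open>The systems of \<open>G'\<close> are grouped by the system of \<open>G\<close> they
  extend. The return pattern varies with that system, but each group of 16 sums to a value that
  depends on its face numbers only.\<close>

theorem sum_rotation_systems_claw_step:
  "(\<Sum>\<rho>\<in>rotation_systems G'. g (root_face_count G' u' \<rho>) (other_face_count G' u' \<rho>)) =
   (\<Sum>\<rho>\<in>rotation_systems G. claw_step g (root_face_count G u \<rho>) (other_face_count G u \<rho>))"
  unfolding sum_rotation_systems_ext
proof (rule sum.cong[OF refl])
  fix \<rho> assume \<rho>: "\<rho> \<in> rotation_systems G"
  obtain p b where pb: "bij p" "\<And>i. \<rho> (u, a i, lab i) = (u, a (turn b i), lab (turn b i))"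
      "first_return (\<rho> \<circ> dart_rev G) (arcs G) root_codes (root_dart u a) (root_return p b)"
    using root_return_exists[OF \<rho>] by metis
  show "(\<Sum>t0\<in>UNIV. \<Sum>t1\<in>UNIV. \<Sum>t2\<in>UNIV. \<Sum>b\<in>UNIV.
      g (root_face_count G' u' (ext_rot \<rho> t0 t1 t2 b)) (other_face_count G' u' (ext_rot \<rho> t0 t1 t2 b))) =
    claw_step g (root_face_count G u \<rho>) (other_face_count G u \<rho>)"
    unfolding ext_face_counts[OF \<rho> pb(2,3)] root_face_count_eq[OF \<rho> pb(3)]
    by (rule sum_claw_returns(2)[OF pb(1)])
qed

end


section \<open>Genus polynomials of iterated claws\<close>

fun claw_neighbour :: "nat \<Rightarrow> idx \<Rightarrow> claw_vert" where
  "claw_neighbour 0 i = Base"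
| "claw_neighbour (Suc n) i = Sub (Suc n) (lab i)"

lemma claw_ext_new_root:
  assumes "claw_ext G u a s u'" shows "rooted_claw (claw_extension G u s u') u' (\<lambda>i. s (lab i))"
proof -
  interpret claw_ext G u a s u' by fact
  show ?thesis using ext_rooted_claw by (simp add: w_def[abs_def])
qed

lemma rooted_claw_0: "rooted_claw (iterated_claw 0) (Root 0) (claw_neighbour 0)"
proof
  fix x y j
  show "(Root 0, x, j) \<in> arcs (iterated_claw 0) \<longleftrightarrow> (\<exists>i. x = claw_neighbour 0 i \<and> j = lab i)"
  proof -
    have "j \<in> {0, 1, 2} \<longleftrightarrow> (\<exists>i. j = lab i)"
    proof
      assume "j \<in> {0, 1, 2}"
      then have "j = lab I0 \<or> j = lab I1 \<or> j = lab I2" by auto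
      then show "\<exists>i. j = lab i" by blast
    next
      assume "\<exists>i. j = lab i"
      then obtain i where "j = lab i" by blast
      then show "j \<in> {0, 1, 2}" by (cases i) auto
    qed
    then show ?thesis by (auto simp: dart_graph_def edge_def)
  qed
qed (auto simp: dart_graph_def edge_def)

text \<open>The bound on the vertex names is carried along because it makes
  \<open>Sub (Suc n) _\<close> and \<open>Root (Suc n)\<close> fresh.\<close>

lemma rooted_claw_verts:
  "rooted_claw (iterated_claw n) (Root n) (claw_neighbour n) \<and>
   verts (iterated_claw n) \<subseteq> {Base} \<union> Root ` {..n} \<union> {Sub k j | k j. k \<le> n}"
proof (induction n)
  case 0
  have "verts (iterated_claw 0) = {Base, Root 0}" by (simp add: dart_graph_def)
  then show ?case using rooted_claw_0 by blast
next
  case (Suc n)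
  then interpret rooted_claw "iterated_claw n" "Root n" "claw_neighbour n" by blast
  have ext: "claw_ext (iterated_claw n) (Root n) (claw_neighbour n) (Sub (Suc n)) (Root (Suc n))"
    by standard (use Suc in auto)
  have "verts (iterated_claw (Suc n)) =
      verts (iterated_claw n) \<union> range (\<lambda>i. Sub (Suc n) (lab i)) \<union> {Root (Suc n)}"
    using claw_ext.verts_ext[OF ext] by (simp add: claw_ext.w_def[OF ext, abs_def])
  then show ?case
    using claw_ext_new_root[OF ext] Suc by (auto simp: fun_eq_iff)
qed

interpretation claw: rooted_claw "iterated_claw n" "Root n" "claw_neighbour n" for n
  using rooted_claw_verts by blast

interpretation claw: claw_ext "iterated_claw n" "Root n" "claw_neighbour n" "Sub (Suc n)" "Root (Suc n)" for n
  by standard (use rooted_claw_verts[of n] in auto)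

lemma card_verts_claw: "card (verts (iterated_claw n)) = 2 + 4 * n"
proof (induction n)
  case (Suc n)
  have "card (range (claw.w n)) = card (UNIV :: idx set)"
    by (intro card_image injI) simp
  also have "\<dots> = 3" by (simp add: UNIV_idx)
  finally have w: "card (range (claw.w n)) = 3" .
  have disj: "verts (iterated_claw n) \<inter> range (claw.w n) = {}"
    using claw.not_vert(1)[of n] by blast
  have notin: "Root (Suc n) \<notin> verts (iterated_claw n) \<union> range (claw.w n)"
    using claw.not_vert(2)[of n] claw.new(2)[of n] by blast
  have "card (verts (iterated_claw (Suc n))) = Suc (card (verts (iterated_claw n) \<union> range (claw.w n)))"
    using claw.verts_ext[of n] claw.fin(1)[of n] notin by simp
  also have "card (verts (iterated_claw n) \<union> range (claw.w n)) = card (verts (iterated_claw n)) + 3"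
    using card_Un_disjoint[OF claw.fin(1)[of n] _ disj] w by simp
  finally show ?case using Suc by simp
qed (simp add: dart_graph_def)

text \<open>The six darts at the old root give way to 18 new ones.\<close>

lemma card_arcs_claw: "card (arcs (iterated_claw n)) = 6 + 12 * n"
proof (induction n)
  case 0
  have "arcs (iterated_claw 0) = {(Base, Root 0, 0), (Base, Root 0, 1), (Base, Root 0, 2),
      (Root 0, Base, 0), (Root 0, Base, 1), (Root 0, Base, 2)}"
    by (auto simp: dart_graph_def edge_def)
  then show ?case by simp
next
  case (Suc n)
  let ?xd = "ext_dart (Root n) (claw_neighbour n) (claw.w n) (Root (Suc n))"
  have codes: "card (UNIV :: (kind \<times> idx) set) = 18" "card root_codes = 6"
    unfolding root_codes_def UNIV_Times_UNIV[symmetric] card_cartesian_product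
    by (simp_all add: UNIV_idx UNIV_kind)
  have touch: "card (arcs (iterated_claw n) \<inter> touching (Root n)) = 6"
    using card_image[OF claw.inj_root_dart[of n]] codes(2) unfolding claw.root_dart_image by simp
  have "card (claw.old_arcs n) + 6 = card (arcs (iterated_claw n))"
    using card_Diff_subset_Int[of "arcs (iterated_claw n)" "touching (Root n)"] claw.fin(2)[of n] touch
      card_mono[of "arcs (iterated_claw n)" "arcs (iterated_claw n) \<inter> touching (Root n)"]
    unfolding claw.old_arcs_def by simp
  moreover have "card (range ?xd) = 18"
    using card_image[OF claw.inj_xd[of n]] codes(1) by simp
  moreover have "claw.old_arcs n \<inter> range ?xd = {}"
    using claw.old_arcs_not_xd[of _ n] by blast
  moreover have "finite (claw.old_arcs n)"
    using claw.fin(2)[of n] by (simp add: claw.old_arcs_def)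
  ultimately have "card (arcs (iterated_claw (Suc n))) = card (claw.old_arcs n) + 18"
    using claw.arcs_ext[of n] card_Un_disjoint[of "claw.old_arcs n" "range ?xd"] by simp
  then show ?case using Suc \<open>card (claw.old_arcs n) + 6 = _\<close> by simp
qed

section \<open>Transfer of weighted sums over rotation systems along a claw extension\<close>

definition rotation_sum :: "nat \<Rightarrow> (nat \<Rightarrow> nat \<Rightarrow> nat) \<Rightarrow> nat" where
  "rotation_sum n g = (\<Sum>\<rho>\<in>rotation_systems (iterated_claw n).
     g (root_face_count (iterated_claw n) (Root n) \<rho>) (other_face_count (iterated_claw n) (Root n) \<rho>))"

lemma rotation_sum_Suc: "rotation_sum (Suc n) g = rotation_sum n (claw_step g)"
  using claw.sum_rotation_systems_claw_step[of g n] by (simp add: rotation_sum_def)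

declare iterated_claw.simps [simp del]

lemma rotation_sum_0: "rotation_sum 0 g = 2 * g 3 0 + 2 * g 1 0"
proof -
  let ?G = "iterated_claw 0" and ?a = "claw_neighbour 0"
  let ?d = "\<lambda>i. (Root 0, Base, lab i)" and ?e = "\<lambda>i. (Base, Root 0, lab i)"
  have inj: "inj ?d" "inj ?e" by (auto intro: injI)
  have arcs: "arcs ?G = range ?d \<union> range ?e"
  proof -
    have "arcs ?G = {(Root 0, Base, 0), (Root 0, Base, 1), (Root 0, Base, 2)} \<union>
        {(Base, Root 0, 0), (Base, Root 0, 1), (Base, Root 0, 2)}"
      by (auto simp: iterated_claw.simps dart_graph_def edge_def)
    then show ?thesis by (simp add: UNIV_idx)
  qed
  have touching: "arcs ?G \<subseteq> touching (Root 0)" unfolding arcs by (auto simp: touching_def)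
  have "verts ?G = {Base, Root 0}" by (simp add: iterated_claw.simps dart_graph_def)
  moreover have "out_arcs ?G Base = range ?e" "out_arcs ?G (Root 0) = range ?d"
    unfolding out_arcs_def arcs claw.tail by auto
  ultimately have "out_arcs ?G ` verts ?G - {{}} = insert (range ?d) (insert (range ?e) {})" by auto
  moreover have "tail ?G x \<in> verts ?G" if "x \<in> arcs ?G" for x
    using that claw.vert[of _ _ _ 0] by (cases x) (auto simp: claw.tail)
  ultimately have RS: "rotation_systems ?G = cyclic_perms (insert (range ?d) (insert (range ?e) {}))"
    using rotation_systems_eq[of ?G] by simp
  have "cyclic_perms ({} :: claw_vert dart set set) = {id}"
    by (auto simp: cyclic_perms_def)
  then have sum: "(\<Sum>\<rho>\<in>rotation_systems ?G. f \<rho>) = (\<Sum>b1\<in>UNIV. \<Sum>b2\<in>UNIV. f (rot3 ?e b1 \<circ> rot3 ?d b2))"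
    for f :: "_ \<Rightarrow> nat"
    unfolding RS by (subst sum_cyclic_perms_insert[OF inj(1)], force, subst sum_cyclic_perms_insert[OF inj(2)], force) simp
  \<comment> \<open>Membership is extracted by summing the indicator of non-membership, which is
    zero over the rotation systems, through the reindexing \<open>sum\<close>.\<close>
  have mem: "rot3 ?e b1 \<circ> rot3 ?d b2 \<in> rotation_systems ?G" for b1 b2
  proof -
    have "finite (rotation_systems ?G)" by (rule claw.finite_rotation_systems)
    moreover have "(\<Sum>b1\<in>UNIV. \<Sum>b2\<in>UNIV.
        (if rot3 ?e b1 \<circ> rot3 ?d b2 \<in> rotation_systems ?G then 0 else 1 :: nat)) = 0"
      by (rule trans[OF sum[of "\<lambda>\<rho>. if \<rho> \<in> rotation_systems ?G then 0 else 1", symmetric]]) simp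
    ultimately show ?thesis
      by (simp only: sum_eq_0_iff finite_UNIV) (auto split: if_splits)
  qed
  have counts: "root_face_count ?G (Root 0) (rot3 ?e b1 \<circ> rot3 ?d b2) = root_faces (root_return (turn b1) b2) root_codes"
    "other_face_count ?G (Root 0) (rot3 ?e b1 \<circ> rot3 ?d b2) = 0" for b1 b2
  proof -
    let ?\<rho> = "rot3 ?e b1 \<circ> rot3 ?d b2"
    have out: "rot3 ?d b2 (?e i) = ?e i" "rot3 ?e b1 (?d i) = ?d i" for i
      by (rule rot3_outside; force)+
    have \<rho>: "?\<rho> (?e i) = ?e (turn b1 i)" "?\<rho> (?d i) = ?d (turn b2 i)" for i
      by (simp_all only: comp_apply out rot3_apply[OF inj(2)] rot3_apply[OF inj(1)])
    have rev: "dart_rev ?G (?d i) = ?e i" "dart_rev ?G (?e i) = ?d i" for i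
      by (rule claw.dart_rev_arc, simp add: arcs)+
    have "first_return (?\<rho> \<circ> dart_rev ?G) (arcs ?G) root_codes (root_dart (Root 0) ?a) (root_return (turn b1) b2)"
    proof
      show "?\<rho> \<circ> dart_rev ?G permutes arcs ?G" by (rule claw.face_perm_permutes[OF mem])
      show "finite (arcs ?G)" by (rule claw.fin)
      show "inj_on (root_dart (Root 0) ?a) root_codes" by (rule claw.inj_root_dart)
      show "root_dart (Root 0) ?a ` root_codes \<subseteq> arcs ?G" unfolding claw.root_dart_image by blast
      fix c :: "kind \<times> idx" assume "c \<in> root_codes"
      then obtain i where c: "c = (RW, i) \<or> c = (WR, i)" by (auto simp: root_codes_def)
      then show "root_return (turn b1) b2 c \<in> root_codes" by (auto simp: root_codes_def)
      then show "hits (?\<rho> \<circ> dart_rev ?G) (root_dart (Root 0) ?a ` root_codes) (root_dart (Root 0) ?a c)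
          (root_dart (Root 0) ?a (root_return (turn b1) b2 c))"
        by (intro hits_step imageI) (use c rev \<rho> in auto)
    qed
    then show "root_face_count ?G (Root 0) ?\<rho> = root_faces (root_return (turn b1) b2) root_codes"
      by (rule claw.root_face_count_eq[OF mem])
    have "S \<inter> touching (Root 0) \<noteq> {}" if "S \<in> faces ?G (dart_rev ?G) ?\<rho>" for S
    proof -
      have "S \<subseteq> touching (Root 0)" using claw.face_subset[OF mem that] touching by (rule subset_trans)
      moreover have "S \<noteq> {}" using that orbit_nonempty unfolding faces_def by fast
      ultimately show ?thesis by (simp add: Int_absorb2)
    qed
    then have "{S \<in> faces ?G (dart_rev ?G) ?\<rho>. S \<inter> touching (Root 0) = {}} = {}" by blast
    then show "other_face_count ?G (Root 0) ?\<rho> = 0" unfolding other_face_count_def by (simp only: card.empty)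
  qed
  have "turn True = tri (I1, I2, I0)" "turn False = tri (I2, I0, I1)" by (simp_all add: turn_def)
  moreover have "(I1, I2, I0) \<in> set perms3" "(I2, I0, I1) \<in> set perms3" by (simp_all add: perms3_def)
  ultimately have "root_faces (root_return (turn b1) b2) root_codes = (if b1 = b2 then 1 else 3)" for b1 b2
    using root_faces_root_return root_decomps_dipole by (cases b1; cases b2) simp_all
  then show ?thesis
    unfolding rotation_sum_def sum counts by (simp add: UNIV_bool)
qed

text \<open>\<open>genus_weight n m i\<close> selects the rotation systems of genus \<open>i\<close> with \<open>m\<close> faces at the root.\<close>

definition genus_weight :: "nat \<Rightarrow> nat \<Rightarrow> int \<Rightarrow> nat \<Rightarrow> nat \<Rightarrow> nat" where
  "genus_weight n m i m' k = of_bool (m' = m \<and> int (k + m) = 2 * int n + 3 - 2 * i)"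

lemma rotation_sum_cong:
  "(\<And>m k. m \<in> {1, 2, 3} \<Longrightarrow> g m k = g' m k) \<Longrightarrow> rotation_sum n g = rotation_sum n g'"
  unfolding rotation_sum_def using claw.root_face_count_range by (intro sum.cong) auto

lemma rotation_sum_linear:
  "rotation_sum n (\<lambda>m k. c * g m k) = c * rotation_sum n g"
  "rotation_sum n (\<lambda>m k. g m k + g' m k) = rotation_sum n g + rotation_sum n g'"
  by (simp_all add: rotation_sum_def sum.distrib sum_distrib_left)

text \<open>Passing from \<open>n\<close> to \<open>Suc n\<close> raises the number of faces
  required for a given genus by 2, so an outcome that gains \<open>2 - 2 * d\<close> faces comes
  from genus \<open>i - d\<close>.\<close>

lemma rotation_sum_genus_weight_Suc:
  "rotation_sum (Suc n) (genus_weight (Suc n) 3 i) =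
     8 * rotation_sum n (genus_weight n 1 i) + 2 * rotation_sum n (genus_weight n 2 i)"
  "rotation_sum (Suc n) (genus_weight (Suc n) 2 i) =
     12 * rotation_sum n (genus_weight n 2 (i - 1)) + 12 * rotation_sum n (genus_weight n 3 (i - 1))"
  "rotation_sum (Suc n) (genus_weight (Suc n) 1 i) =
     8 * rotation_sum n (genus_weight n 1 (i - 1)) + (2 * rotation_sum n (genus_weight n 2 (i - 1)) +
       4 * rotation_sum n (genus_weight n 3 (i - 2)))"
  unfolding rotation_sum_Suc rotation_sum_linear[symmetric]
  by (rule rotation_sum_cong; auto simp: claw_step_def genus_weight_def)+

text \<open>A, B, C are the cases \<open>m = 3\<close>, \<open>m = 2\<close>, \<open>m = 1\<close>.
  The start records the dipole: two spherical embeddings with three faces, two toroidal ones with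
  one face.\<close>

fun face_poly :: "nat \<Rightarrow> nat \<Rightarrow> real poly" where
  "face_poly 0 m = (if m = 3 then [:2:] else if m = 1 then [:0, 2:] else 0)"
| "face_poly (Suc n) m =
    (if m = 3 then smult 8 (face_poly n 1) + smult 2 (face_poly n 2)
     else if m = 2 then pCons 0 (smult 12 (face_poly n 2) + smult 12 (face_poly n 3))
     else if m = 1 then pCons 0 (smult 8 (face_poly n 1) + smult 2 (face_poly n 2) + pCons 0 (smult 4 (face_poly n 3)))
     else 0)"

text \<open>Integer indices, with value zero below 0, make multiplication by \<open>z\<close> a
  plain shift without a case distinction at the constant term.\<close>

definition icoeff :: "real poly \<Rightarrow> int \<Rightarrow> real" where
  "icoeff p i = (if i < 0 then 0 else coeff p (nat i))"

lemma icoeff_simps: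
  "icoeff (p + q) i = icoeff p i + icoeff q i"
  "icoeff (smult c p) i = c * icoeff p i"
  "icoeff (pCons 0 p) i = icoeff p (i - 1)"
proof -
  show "icoeff (pCons 0 p) i = icoeff p (i - 1)"
  proof (cases "i \<le> 0")
    case True
    then show ?thesis by (simp add: icoeff_def)
  next
    case False
    then have "nat i = Suc (nat (i - 1))" by simp
    then show ?thesis using False by (simp only: icoeff_def coeff_pCons_Suc) simp
  qed
qed (simp_all add: icoeff_def)

lemma rotation_sum_eq_icoeff:
  "m \<in> {1, 2, 3} \<Longrightarrow> real (rotation_sum n (genus_weight n m i)) = icoeff (face_poly n m) i"
proof (induction n arbitrary: m i)
  case 0
  have "m = 1 \<or> m = 2 \<or> m = 3" using 0 by auto
  moreover have "icoeff [:2:] i = (if i = 0 then 2 else 0)" "icoeff [:0, 2:] i = (if i = 1 then 2 else 0)"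
    by (auto simp: icoeff_def coeff_pCons split: nat.splits)
  ultimately show ?case
    by (auto simp: rotation_sum_0 genus_weight_def icoeff_def)
next
  case (Suc n)
  then have "m = 1 \<or> m = 2 \<or> m = 3" by auto
  then show ?case
    using Suc.IH[of 1] Suc.IH[of 2] Suc.IH[of 3]
    by (elim disjE) (simp_all add: rotation_sum_genus_weight_Suc
      rotation_sum_genus_weight_Suc(3)[unfolded One_nat_def] icoeff_simps)
qed

definition claw_gamma :: "nat \<Rightarrow> real poly" where
  "claw_gamma n = face_poly n 1 + face_poly n 2 + face_poly n 3"

text \<open>With \<open>2 + 4 * n\<close> vertices and \<open>3 + 6 * n\<close> edges, Euler's
  formula asks for \<open>2 * n + 3 - 2 * i\<close> faces.\<close>

lemma genus_count_claw: "real (genus_count (iterated_claw n) (dart_rev (iterated_claw n)) i) = coeff (claw_gamma n) i"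
proof -
  let ?G = "iterated_claw n"
  let ?m = "root_face_count ?G (Root n)" and ?k = "other_face_count ?G (Root n)"
  have "genus_count ?G (dart_rev ?G) i = (\<Sum>\<rho>\<in>rotation_systems ?G.
      of_bool (int (?k \<rho> + ?m \<rho>) = 2 * int n + 3 - 2 * int i))"
  proof -
    have "(6 + 12 * n) div 2 = 3 + 6 * n" by simp
    then have "{\<rho> \<in> rotation_systems ?G. int (card (verts ?G)) - int (card (arcs ?G) div 2)
          + int (card (faces ?G (dart_rev ?G) \<rho>)) = 2 - 2 * int i} =
        rotation_systems ?G \<inter> {\<rho>. int (?k \<rho> + ?m \<rho>) = 2 * int n + 3 - 2 * int i}"
      unfolding card_verts_claw card_arcs_claw claw.card_faces by auto
    then show ?thesis
      using claw.finite_rotation_systems[of n] by (simp add: genus_count_def)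
  qed
  also have "\<dots> = rotation_sum n (\<lambda>m k. genus_weight n 1 i m k + (genus_weight n 2 i m k + genus_weight n 3 i m k))"
    unfolding rotation_sum_def
    using claw.root_face_count_range by (intro sum.cong) (fastforce simp: genus_weight_def)+
  finally show ?thesis
    by (simp add: rotation_sum_linear rotation_sum_eq_icoeff claw_gamma_def icoeff_def)
qed

lemma claw_genus_poly_eq: "claw_genus_poly n = claw_gamma n"
proof (rule poly_eqI)
  fix i
  let ?c = "genus_count (iterated_claw n) (dart_rev (iterated_claw n))"
  have c: "real (?c j) = coeff (claw_gamma n) j" for j by (rule genus_count_claw)
  have "{j. ?c j \<noteq> 0} \<subseteq> {..degree (claw_gamma n)}"
    using c le_degree by (metis (mono_tags, lifting) atMost_iff mem_Collect_eq of_nat_eq_0_iff subsetI)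
  then have fin: "finite {j. ?c j \<noteq> 0}" by (rule finite_subset) simp
  have "coeff (claw_genus_poly n) i = (\<Sum>j | ?c j \<noteq> 0. if j = i then real (?c j) else 0)"
    unfolding claw_genus_poly_def genus_poly_def by (simp add: coeff_sum)
  also have "\<dots> = (if ?c i \<noteq> 0 then real (?c i) else 0)"
    using fin by (subst sum.delta) auto
  finally show "coeff (claw_genus_poly n) i = coeff (claw_gamma n) i"
    using c[of i] by (cases "?c i = 0") simp_all
qed


section \<open>Interlacing of negative roots\<close>

lemma poly_eq_prod_roots:
  fixes p :: "'a::idom poly"
  assumes "degree p = d" "\<And>i. i < d \<Longrightarrow> poly p (x i) = 0" "inj_on x {..<d}"
  shows "p = smult (lead_coeff p) (\<Prod>i<d. [:- x i, 1:])"
  using assms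
proof (induction d arbitrary: p)
  case 0
  then show ?case by (auto elim!: degree_eq_zeroE)
next
  case (Suc d)
  have "poly p (x d) = 0" using Suc.prems(2) by simp
  then obtain r where r: "p = [:- x d, 1:] * r"
    by (metis poly_eq_0_iff_dvd dvdE)
  have "r \<noteq> 0" using r Suc.prems(1) by auto
  then have deg: "degree r = d"
    using Suc.prems(1) unfolding r by (subst (asm) degree_mult_eq) auto
  have "poly r (x i) = 0" if "i < d" for i
  proof -
    have "(x i - x d) * poly r (x i) = 0" using Suc.prems(2)[of i] that by (auto simp: r)
    moreover have "x i \<noteq> x d" using Suc.prems(3) that by (auto dest: inj_onD)
    ultimately show ?thesis by simp
  qed
  then have "r = smult (lead_coeff r) (\<Prod>i<d. [:- x i, 1:])"
    using deg Suc.prems(3) by (intro Suc.IH) (auto intro: inj_on_subset)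
  moreover have "lead_coeff p = lead_coeff r" unfolding r lead_coeff_mult by simp
  ultimately show ?case
    using r by (metis (no_types, lifting) mult.commute mult_smult_left prod.lessThan_Suc)
qed

definition descending_roots :: "real poly \<Rightarrow> (nat \<Rightarrow> real) \<Rightarrow> bool" where
  "descending_roots p x \<longleftrightarrow> lead_coeff p > 0 \<and>
     (\<forall>i<degree p. x i < 0 \<and> poly p (x i) = 0) \<and> (\<forall>i j. i < j \<and> j < degree p \<longrightarrow> x j < x i)"

lemma descending_roots_inj_on:
  assumes x: "descending_roots p x"
  shows "inj_on x {..<degree p}"
proof (rule inj_onI)
  fix i j assume "i \<in> {..<degree p}" "j \<in> {..<degree p}" "x i = x j"
  then show "i = j" using x unfolding descending_roots_def by (cases i j rule: linorder_cases) fastforce+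
qed

text \<open>Each root above \<open>t\<close> contributes a negative linear factor, each root below a
  positive one. Numbering from the largest root makes the sign independent of the degree.\<close>

lemma descending_roots_sign:
  assumes x: "descending_roots p x" and "i \<le> degree p"
    and above: "\<And>j. j < i \<Longrightarrow> t < x j" and below: "\<And>j. i \<le> j \<Longrightarrow> j < degree p \<Longrightarrow> x j < t"
  shows "(-1) ^ i * poly p t > 0"
proof -
  have "p = smult (lead_coeff p) (\<Prod>i<degree p. [:- x i, 1:])"
    using x by (intro poly_eq_prod_roots descending_roots_inj_on[OF x]) (auto simp: descending_roots_def)
  then have "poly p t = lead_coeff p * (\<Prod>j<degree p. t - x j)"
    by (metis (no_types, lifting) poly_smult poly_prod poly_pCons poly_0 mult_zero_right add.right_neutral
        mult.right_neutral prod.cong uminus_add_conv_diff)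
  also have "{..<degree p} = {..<i} \<union> {i..<degree p}" using assms(2) by auto
  also have "(\<Prod>j\<in>{..<i} \<union> {i..<degree p}. t - x j) = (\<Prod>j<i. t - x j) * (\<Prod>j=i..<degree p. t - x j)"
    by (rule prod.union_disjoint) auto
  also have "(\<Prod>j<i. t - x j) = (-1) ^ i * (\<Prod>j<i. x j - t)"
  proof -
    have "(\<Prod>j<i. t - x j) = (\<Prod>j<i. (-1) * (x j - t))" by (intro prod.cong) auto
    then show ?thesis unfolding prod.distrib by simp
  qed
  finally have "(-1) ^ i * poly p t = lead_coeff p * ((\<Prod>j<i. x j - t) * (\<Prod>j=i..<degree p. t - x j))"
    by (simp add: power_add[symmetric] mult.assoc[symmetric])
  moreover have "(\<Prod>j<i. x j - t) > 0" "(\<Prod>j=i..<degree p. t - x j) > 0"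
    using above below by (auto intro!: prod_pos)
  ultimately show ?thesis using x by (simp add: descending_roots_def)
qed

lemma descending_roots_set:
  assumes x: "descending_roots p x"
  shows "{t. poly p t = 0} = x ` {..<degree p}" "card {t. poly p t = 0} = degree p"
proof -
  have p: "p \<noteq> 0" using x by (auto simp: descending_roots_def)
  have card: "card (x ` {..<degree p}) = degree p"
    using descending_roots_inj_on[OF x] by (simp add: card_image)
  have sub: "x ` {..<degree p} \<subseteq> {t. poly p t = 0}" using x by (auto simp: descending_roots_def)
  show eq: "{t. poly p t = 0} = x ` {..<degree p}"
    using card_seteq[OF poly_roots_finite[OF p] sub] card_poly_roots_bound[OF p] card by simp
  show "card {t. poly p t = 0} = degree p" using card eq by simp
qed

lemma descending_roots_sorted_list:
  assumes x: "descending_roots p x"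
  shows "sorted_list_of_set (real_roots p) = map x (rev [0..<degree p])"
proof -
  have "sorted_wrt (<) (map x (rev [0..<degree p]))"
    using x by (auto simp: sorted_wrt_iff_nth_less rev_nth descending_roots_def)
  then have "sorted_list_of_set (set (map x (rev [0..<degree p]))) = map x (rev [0..<degree p])"
    by (intro sorted_list_of_set.idem_if_sorted_distinct) (auto simp: strict_sorted_iff)
  moreover have "set (map x (rev [0..<degree p])) = real_roots p"
    using descending_roots_set(1)[OF x] by (auto simp: real_roots_def lessThan_atLeast0)
  ultimately show ?thesis by simp
qed

text \<open>The roots are indexed from the largest one, starting with \<open>0\<close>.\<close>

definition nth_root :: "real poly \<Rightarrow> nat \<Rightarrow> real" where
  "nth_root p i = sorted_list_of_set (real_roots p) ! (degree p - 1 - i)"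

lemma nth_root_eq:
  assumes "descending_roots p x" "i < degree p" shows "nth_root p i = x i"
  using assms by (simp add: nth_root_def descending_roots_sorted_list rev_nth)

lemma descending_roots_nth_root:
  assumes "descending_roots p x" shows "descending_roots p (nth_root p)"
  using assms nth_root_eq[OF assms] by (auto simp: descending_roots_def)

text \<open>The \<open>degree p + 1\<close> sample points of alternating sign bound
  \<open>degree p\<close> disjoint intervals, each with a root by the intermediate value
  theorem.\<close>

lemma descending_roots_exist:
  fixes p :: "real poly"
  assumes lc: "lead_coeff p > 0" and T0: "T 0 \<le> 0"
    and dec: "\<And>i. i < degree p \<Longrightarrow> T (Suc i) < T i"
    and sgn: "\<And>i. i \<le> degree p \<Longrightarrow> (-1) ^ i * poly p (T i) > 0"
  shows "descending_roots p (nth_root p) \<and> (\<forall>i<degree p. T (Suc i) < nth_root p i \<and> nth_root p i < T i)"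
proof -
  have "\<exists>t. T (Suc i) < t \<and> t < T i \<and> poly p t = 0" if i: "i < degree p" for i
  proof -
    have "poly p (T (Suc i)) * poly p (T i) < 0"
      using sgn[of i] sgn[of "Suc i"] i by (cases "even i") (auto simp: mult_less_0_iff)
    then show ?thesis using poly_IVT[OF dec[OF i]] by blast
  qed
  then obtain x where x: "\<And>i. i < degree p \<Longrightarrow> T (Suc i) < x i \<and> x i < T i \<and> poly p (x i) = 0" by metis
  have mono: "T j \<le> T i" if "i \<le> j" "j \<le> degree p" for i j
    using that
  proof (induction j rule: dec_induct)
    case (step n)
    then show ?case using dec[of n] by simp
  qed simp
  have "x j < x i" if "i < j" "j < degree p" for i j
    using x[of i] x[of j] mono[of "Suc i" j] that by linarith
  moreover have "x i < 0" if "i < degree p" for i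
    using x[OF that] mono[of 0 i] T0 that by linarith
  ultimately have desc: "descending_roots p x" using lc x by (auto simp: descending_roots_def)
  then show ?thesis using descending_roots_nth_root nth_root_eq x by auto
qed

text \<open>Reflection at 0 turns minus infinity into plus infinity; the factor
  \<open>(-1) ^ degree p\<close> restores the leading coefficient.\<close>

lemma poly_sign_at_bot:
  fixes p :: "real poly"
  assumes "lead_coeff p > 0"
  obtains M where "M < c" "(-1) ^ degree p * poly p M > 0"
proof -
  define q where "q = smult ((-1) ^ degree p) (p \<circ>\<^sub>p [:0, -1:])"
  have "lead_coeff q = (-1) ^ degree p * (lead_coeff p * (-1) ^ degree p)"
    unfolding q_def by (simp add: lead_coeff_comp)
  also have "\<dots> = lead_coeff p" by (simp add: mult.left_commute flip: power_mult_distrib)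
  finally have "lead_coeff q > 0" using assms by simp
  then obtain n where n: "\<And>t. t \<ge> n \<Longrightarrow> poly q t \<ge> lead_coeff q"
    using poly_pinfty_gt_lc by blast
  let ?t = "max n (1 - c)"
  have "poly q ?t > 0" using n[of ?t] \<open>lead_coeff q > 0\<close> by simp
  then have "(-1) ^ degree p * poly p (- ?t) > 0" by (simp add: q_def poly_pcompose)
  moreover have "- ?t < c" by simp
  ultimately show thesis using that by blast
qed

text \<open>\<open>interlaces p q\<close>: the roots alternate, and the largest one belongs to \<open>p\<close>.\<close>

definition interlaces :: "real poly \<Rightarrow> real poly \<Rightarrow> bool" where
  "interlaces p q \<longleftrightarrow> descending_roots p (nth_root p) \<and> descending_roots q (nth_root q) \<and>
     (degree p = degree q \<or> degree p = Suc (degree q)) \<and>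
     (\<forall>i<degree q. nth_root q i < nth_root p i) \<and>
     (\<forall>i. Suc i < degree p \<longrightarrow> nth_root p (Suc i) < nth_root q i)"

lemma descending_roots_antimono:
  "descending_roots p x \<Longrightarrow> i \<le> j \<Longrightarrow> j < degree p \<Longrightarrow> x j \<le> x i"
  unfolding descending_roots_def by (cases "i = j") (auto intro: less_imp_le)

text \<open>Exactly \<open>Suc i\<close> roots of \<open>p\<close> lie above root \<open>i\<close>
  of \<open>q\<close>, and exactly \<open>i\<close> roots of \<open>q\<close> lie above root
  \<open>i\<close> of \<open>p\<close>.\<close>

lemma interlaces_sign:
  assumes pq: "interlaces p q"
  shows "i < degree q \<Longrightarrow> (-1) ^ Suc i * poly p (nth_root q i) > 0"
    and "i < degree p \<Longrightarrow> (-1) ^ i * poly q (nth_root p i) > 0"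
proof -
  have p: "descending_roots p (nth_root p)" and q: "descending_roots q (nth_root q)"
    and deg: "degree q \<le> degree p" "degree p \<le> Suc (degree q)"
    and lt: "\<And>i. i < degree q \<Longrightarrow> nth_root q i < nth_root p i"
      "\<And>i. Suc i < degree p \<Longrightarrow> nth_root p (Suc i) < nth_root q i"
    using pq by (auto simp: interlaces_def)
  show "(-1) ^ Suc i * poly p (nth_root q i) > 0" if i: "i < degree q"
  proof (rule descending_roots_sign[OF p])
    show "nth_root q i < nth_root p j" if "j < Suc i" for j
      using descending_roots_antimono[OF p, of j i] lt(1)[OF i] that i deg by simp
    show "nth_root p j < nth_root q i" if "Suc i \<le> j" "j < degree p" for j
      using descending_roots_antimono[OF p, of "Suc i" j] lt(2)[of i] that by simp
  qed (use i deg in simp)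
  show "(-1) ^ i * poly q (nth_root p i) > 0" if i: "i < degree p"
  proof (rule descending_roots_sign[OF q])
    show "nth_root p i < nth_root q j" if "j < i" for j
      using descending_roots_antimono[OF p, of "Suc j" i] lt(2)[of j] that i by simp
    show "nth_root q j < nth_root p i" if "i \<le> j" "j < degree q" for j
      using descending_roots_antimono[OF p, of i j] lt(1)[of j] that deg by simp
  qed (use i deg in simp)
qed

text \<open>The roots of \<open>q\<close>, the point 0 and a point far to the left are one more
  sample point than there are roots to be found.\<close>

lemma interlacesI_Suc:
  assumes q: "descending_roots q (nth_root q)" and deg: "degree p = Suc (degree q)"
    and lc: "lead_coeff p > 0" and p0: "poly p 0 > 0"
    and sgn: "\<And>i. i < degree q \<Longrightarrow> (-1) ^ Suc i * poly p (nth_root q i) > 0"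
  shows "interlaces p q"
proof -
  let ?e = "degree q"
  obtain M where M: "M < min 0 (nth_root q (?e - 1))" "(-1) ^ degree p * poly p M > 0"
    using poly_sign_at_bot[OF lc] by blast
  define T where "T i = (if i = 0 then 0 else if i \<le> ?e then nth_root q (i - 1) else M)" for i
  have root: "descending_roots p (nth_root p) \<and> (\<forall>i<degree p. T (Suc i) < nth_root p i \<and> nth_root p i < T i)"
  proof (rule descending_roots_exist[OF lc])
    fix i assume i: "i < degree p"
    consider "Suc i \<le> ?e" "i = 0" | "Suc i \<le> ?e" "i > 0" | "i = ?e" using i deg by linarith
    then show "T (Suc i) < T i"
    proof cases
      case 1
      then show ?thesis using q by (auto simp: T_def descending_roots_def)
    next
      case 2
      then have "nth_root q i < nth_root q (i - 1)" using q by (auto simp: descending_roots_def)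
      then show ?thesis using 2 by (auto simp: T_def)
    next
      case 3
      then show ?thesis using M(1) by (auto simp: T_def)
    qed
  next
    fix i assume i: "i \<le> degree p"
    consider "i = 0" | j where "i = Suc j" "j < ?e" | "i = Suc ?e"
      using i deg by (cases i) force+
    then show "(-1) ^ i * poly p (T i) > 0"
    proof cases
      case 1
      then show ?thesis using p0 by (simp add: T_def)
    next
      case (2 j)
      then show ?thesis using sgn[of j] by (simp add: T_def)
    next
      case 3
      then show ?thesis using M(2) deg by (simp add: T_def)
    qed
  qed (simp add: T_def)
  have rt: "T (Suc i) < nth_root p i" "nth_root p i < T i" if "i < degree p" for i
    using root that by blast+
  have "nth_root q i < nth_root p i" if "i < ?e" for i
    using rt[of i] that deg by (simp add: T_def)
  moreover have "nth_root p (Suc i) < nth_root q i" if "Suc i < degree p" for i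
    using rt[of "Suc i"] that deg by (simp add: T_def)
  ultimately show ?thesis using root q deg by (simp add: interlaces_def)
qed

text \<open>With equal degrees the largest root of \<open>q\<close>, not 0, is the rightmost sample
  point; hence \<open>q\<close> comes first in the conclusion.\<close>

lemma interlacesI_eq:
  assumes q: "descending_roots q (nth_root q)" and deg: "degree p = degree q"
    and lc: "lead_coeff p > 0"
    and p0: "poly p 0 > 0"
    and sgn: "\<And>i. i < degree q \<Longrightarrow> (-1) ^ i * poly p (nth_root q i) > 0"
  shows "interlaces q p"
proof -
  let ?d = "degree q"
  obtain M where M: "M < min 0 (nth_root q (?d - 1))" "(-1) ^ degree p * poly p M > 0"
    using poly_sign_at_bot[OF lc] by blast
  \<comment> \<open>For degree 0 the single sample point is 0, where \<open>p0\<close> gives the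
    sign; otherwise index \<open>?d\<close> is the point far to the left.\<close>
  define T where "T i = (if i < ?d then nth_root q i else if ?d = 0 then 0 else M)" for i
  have root: "descending_roots p (nth_root p) \<and> (\<forall>i<degree p. T (Suc i) < nth_root p i \<and> nth_root p i < T i)"
  proof (rule descending_roots_exist[OF lc])
    show "T 0 \<le> 0" using q by (auto simp: T_def descending_roots_def intro: less_imp_le)
  next
    fix i assume i: "i < degree p"
    then consider "Suc i < ?d" | "i = ?d - 1" "?d > 0" using deg by linarith
    then show "T (Suc i) < T i"
    proof cases
      case 1
      then show ?thesis using q by (auto simp: T_def descending_roots_def)
    next
      case 2
      then show ?thesis using M(1) by (auto simp: T_def)
    qed
  next
    fix i assume i: "i \<le> degree p"
    then consider "i < ?d" | "i = ?d" using deg by linarith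
    then show "(-1) ^ i * poly p (T i) > 0"
      using sgn[of i] M(2) p0 deg by cases (auto simp: T_def)
  qed
  have rt: "T (Suc i) < nth_root p i" "nth_root p i < T i" if "i < degree p" for i
    using root that by blast+
  have "nth_root p i < nth_root q i" if "i < ?d" for i
    using rt[of i] that deg by (simp add: T_def)
  moreover have "nth_root q (Suc i) < nth_root p i" if "Suc i < ?d" for i
    using rt[of i] that deg by (simp add: T_def)
  ultimately show ?thesis using root q deg by (simp add: interlaces_def)
qed

section \<open>Interlacing deduced from the recurrence\<close>

lemma weighted_sum_pos: "0 < a \<Longrightarrow> 0 < x \<Longrightarrow> 0 < b \<Longrightarrow> 0 < y \<Longrightarrow> 0 < a * x + b * (y :: real)"
  by (simp add: add_pos_pos)

text \<open>The power of \<open>z\<close> divided out grows only at every second step, which splits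
  the recurrence into two forms by parity.\<close>

locale claw_recurrence =
  fixes U :: "nat \<Rightarrow> real poly"
  assumes U_deg: "degree (U k) = (k + 1) div 2"
    and U_lc: "lead_coeff (U k) > 0"
    and U_0: "poly (U k) 0 > 0"
    and U_init: "U 1 = [:2, 2:]" "U 2 = [:40, 24:]"
    and U_even: "even k \<Longrightarrow> poly (U (k + 3)) t =
      20 * t * poly (U (k + 2)) t + 8 * (3 - 8 * t) * poly (U (k + 1)) t - 384 * t\<^sup>2 * poly (U k) t"
    and U_odd: "odd k \<Longrightarrow> poly (U (k + 3)) t =
      20 * poly (U (k + 2)) t + 8 * (3 - 8 * t) * poly (U (k + 1)) t - 384 * t * poly (U k) t"
begin

text \<open>When the degree grows, the new polynomial has the largest root; otherwise the old one
  has it.\<close>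

definition consecutive :: "nat \<Rightarrow> bool" where
  "consecutive k \<longleftrightarrow> (if even k then interlaces (U (k + 1)) (U k) else interlaces (U k) (U (k + 1)))"

lemma consecutive_descending:
  "consecutive k \<Longrightarrow> descending_roots (U k) (nth_root (U k)) \<and> descending_roots (U (k + 1)) (nth_root (U (k + 1)))"
  by (auto simp: consecutive_def interlaces_def split: if_splits)

lemma interlacing_step:
  assumes c0: "consecutive k" and c1: "consecutive (k + 1)" and i2: "interlaces (U (k + 2)) (U k)"
  shows "consecutive (k + 2) \<and> interlaces (U (k + 3)) (U (k + 1))"
proof -
  have num: "k + 1 + 1 = k + 2" "k + 2 + 1 = k + 3" by simp_all
  let ?x1 = "nth_root (U (k + 1))" and ?x2 = "nth_root (U (k + 2))"
  have x1: "descending_roots (U (k + 1)) ?x1" and x2: "descending_roots (U (k + 2)) ?x2"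
    using consecutive_descending[OF c0] consecutive_descending[OF c1] unfolding num by blast+
  have neg1: "?x1 i < 0" "poly (U (k + 1)) (?x1 i) = 0" if "i < degree (U (k + 1))" for i
    using x1 that by (auto simp: descending_roots_def)
  have neg2: "?x2 i < 0" "poly (U (k + 2)) (?x2 i) = 0" if "i < degree (U (k + 2))" for i
    using x2 that by (auto simp: descending_roots_def)
  show ?thesis
  proof (cases "even k")
    case True
    have a: "interlaces (U (k + 1)) (U k)" "interlaces (U (k + 1)) (U (k + 2))"
      using c0 c1 True unfolding consecutive_def num by simp_all
    have s2: "(-1) ^ Suc i * poly (U (k + 3)) (?x2 i) > 0" if i: "i < degree (U (k + 2))" for i
    proof -
      let ?t = "?x2 i"
      \<comment> \<open>The term with \<open>U (k + 2)\<close> vanishes. The minus sign before 384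
        is absorbed into the exponent; as \<open>?t\<close> is negative, both coefficients are then
        positive, and interlacing fixes the signs of the values of \<open>U (k + 1)\<close> and
        \<open>U k\<close>.\<close>
      have "(-1) ^ Suc i * poly (U (k + 3)) ?t =
          8 * (3 - 8 * ?t) * ((-1) ^ Suc i * poly (U (k + 1)) ?t) + 384 * ?t\<^sup>2 * ((-1) ^ i * poly (U k) ?t)"
        unfolding U_even[OF True] neg2(2)[OF i] by (simp add: algebra_simps)
      also have "\<dots> > 0"
        by (rule weighted_sum_pos[OF _ interlaces_sign(1)[OF a(2) i] _ interlaces_sign(2)[OF i2 i]])
          (use neg2(1)[OF i] in auto)
      finally show ?thesis .
    qed
    have s1: "(-1) ^ Suc i * poly (U (k + 3)) (?x1 i) > 0" if i: "i < degree (U (k + 1))" for i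
    proof -
      let ?t = "?x1 i"
      have "(-1) ^ Suc i * poly (U (k + 3)) ?t =
          20 * (- ?t) * ((-1) ^ i * poly (U (k + 2)) ?t) + 384 * ?t\<^sup>2 * ((-1) ^ i * poly (U k) ?t)"
        unfolding U_even[OF True] neg1(2)[OF i] by (simp add: algebra_simps)
      also have "\<dots> > 0"
        by (rule weighted_sum_pos[OF _ interlaces_sign(2)[OF a(2) i] _ interlaces_sign(2)[OF a(1) i]])
          (use neg1(1)[OF i] in auto)
      finally show ?thesis .
    qed
    have d: "degree (U (k + 3)) = Suc (degree (U (k + 2)))" "degree (U (k + 3)) = Suc (degree (U (k + 1)))"
      using True by (auto simp: U_deg elim!: evenE)
    have "interlaces (U (k + 3)) (U (k + 2))" "interlaces (U (k + 3)) (U (k + 1))"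
      by (rule interlacesI_Suc[OF x2 d(1) U_lc U_0 s2] interlacesI_Suc[OF x1 d(2) U_lc U_0 s1]; assumption)+
    then show ?thesis using True unfolding consecutive_def num by simp
  next
    case False
    have a: "interlaces (U k) (U (k + 1))" "interlaces (U (k + 2)) (U (k + 1))"
      using c0 c1 False unfolding consecutive_def num by simp_all
    have s2: "(-1) ^ i * poly (U (k + 3)) (?x2 i) > 0" if i: "i < degree (U (k + 2))" for i
    proof -
      let ?t = "?x2 i"
      \<comment> \<open>Here \<open>U k\<close> comes with \<open>t\<close> instead of its square,
        so the minus sign before 384 is absorbed by \<open>- ?t\<close> and the exponents stay
        equal.\<close>
      have "(-1) ^ i * poly (U (k + 3)) ?t =
          8 * (3 - 8 * ?t) * ((-1) ^ i * poly (U (k + 1)) ?t) + 384 * (- ?t) * ((-1) ^ i * poly (U k) ?t)"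
        unfolding U_odd[OF False] neg2(2)[OF i] by (simp add: algebra_simps)
      also have "\<dots> > 0"
        by (rule weighted_sum_pos[OF _ interlaces_sign(2)[OF a(2) i] _ interlaces_sign(2)[OF i2 i]])
          (use neg2(1)[OF i] in auto)
      finally show ?thesis .
    qed
    have s1: "(-1) ^ Suc i * poly (U (k + 3)) (?x1 i) > 0" if i: "i < degree (U (k + 1))" for i
    proof -
      let ?t = "?x1 i"
      have "(-1) ^ Suc i * poly (U (k + 3)) ?t =
          20 * ((-1) ^ Suc i * poly (U (k + 2)) ?t) + 384 * (- ?t) * ((-1) ^ Suc i * poly (U k) ?t)"
        unfolding U_odd[OF False] neg1(2)[OF i] by (simp add: algebra_simps)
      also have "\<dots> > 0"
        by (rule weighted_sum_pos[OF _ interlaces_sign(1)[OF a(2) i] _ interlaces_sign(1)[OF a(1) i]])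
          (use neg1(1)[OF i] in auto)
      finally show ?thesis .
    qed
    have d: "degree (U (k + 3)) = degree (U (k + 2))" "degree (U (k + 3)) = Suc (degree (U (k + 1)))"
      using False by (auto simp: U_deg elim!: oddE)
    have "interlaces (U (k + 2)) (U (k + 3))" "interlaces (U (k + 3)) (U (k + 1))"
      by (rule interlacesI_eq[OF x2 d(1) U_lc U_0 s2] interlacesI_Suc[OF x1 d(2) U_lc U_0 s1]; assumption)+
    then show ?thesis using False unfolding consecutive_def num by simp
  qed
qed

lemma interlacing: "consecutive k \<and> consecutive (k + 1) \<and> interlaces (U (k + 2)) (U k)"
proof (induction k)
  case 0
  have x0: "descending_roots (U 0) (nth_root (U 0))"
    using U_deg[of 0] U_lc[of 0] by (simp add: descending_roots_def)
  have deg: "degree (U 0) = 0" "degree (U 1) = 1" "degree (U 2) = 1" by (simp_all add: U_deg)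
  have i1: "interlaces (U 1) (U 0)" "interlaces (U 2) (U 0)"
    using x0 U_lc U_0 deg by (auto intro!: interlacesI_Suc)
  then have x1: "descending_roots (U 1) (nth_root (U 1))" by (simp add: interlaces_def)
  then have "poly (U 1) (nth_root (U 1) 0) = 0" using deg by (simp add: descending_roots_def)
  \<comment> \<open>The only comparison made by hand: \<open>40 + 24 * t\<close> equals 16 at the
    root of \<open>2 + 2 * t\<close>.\<close>
  then have "nth_root (U 1) 0 = -1" unfolding U_init by simp
  then have "poly (U 2) (nth_root (U 1) 0) > 0" unfolding U_init(2) by simp
  then have "interlaces (U 1) (U 2)"
    by (intro interlacesI_eq[OF x1 _ U_lc U_0]) (simp_all add: deg[unfolded One_nat_def])
  then show ?case using i1 by (simp add: consecutive_def numeral_2_eq_2[symmetric])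
next
  case (Suc k)
  moreover have "Suc k = k + 1" "k + 1 + 1 = k + 2" "k + 1 + 2 = k + 3" by simp_all
  ultimately show ?case using interlacing_step[of k] by metis
qed

end


section \<open>The recurrence and its roots\<close>

lemma coeff_face_poly_nonneg: "coeff (face_poly n m) i \<ge> 0"
  by (induction n arbitrary: m i) (auto simp: coeff_pCons split: nat.split)

text \<open>The maximal genus \<open>n + 1\<close> is reached only with a single face at the root,
  so the class \<open>m = 1\<close> carries the leading term.\<close>

lemma face_poly_top:
  "i > n \<Longrightarrow> coeff (face_poly n 3) i = 0" "i > n \<Longrightarrow> coeff (face_poly n 2) i = 0"
  "i > n + 1 \<Longrightarrow> coeff (face_poly n 1) i = 0" "coeff (face_poly n 1) (n + 1) > 0"
proof (induction n arbitrary: i)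
  case (Suc n)
  {
    case 1
    then show ?case using Suc.IH(2)[of i] Suc.IH(3)[of i] by simp
  next
    case 2
    then show ?case using Suc.IH(1)[of "i - 1"] Suc.IH(2)[of "i - 1"] by (cases i) simp_all
  next
    case 3
    then show ?case
      using Suc.IH(1)[of "i - 2"] Suc.IH(2)[of "i - 1"] Suc.IH(3)[of "i - 1"]
      by (auto simp: coeff_pCons split: nat.split)
  next
    case 4
    then show ?case
      using Suc.IH(4) Suc.IH(2)[of "n + 1"] coeff_face_poly_nonneg[of n 3 n]
      by (simp add: add_pos_nonneg)
  }
qed (auto simp: coeff_pCons split: nat.split)

lemma claw_gamma_degree: "degree (claw_gamma n) = n + 1" "lead_coeff (claw_gamma n) > 0"
proof -
  have pos: "coeff (claw_gamma n) (n + 1) > 0"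
    using face_poly_top(1,2)[of n "n + 1"] face_poly_top(4)[of n] by (simp add: claw_gamma_def)
  moreover have "coeff (claw_gamma n) i = 0" if "i > n + 1" for i
    using face_poly_top(1-3)[of n i] that by (simp add: claw_gamma_def)
  ultimately show "degree (claw_gamma n) = n + 1"
    by (intro antisym degree_le le_degree) auto
  then show "lead_coeff (claw_gamma n) > 0" using pos by simp
qed

text \<open>Cayley-Hamilton for the transfer matrix: trace \<open>20 z\<close>, sum of the principal
  2 by 2 minors \<open>64 z^2 - 24 z\<close>, determinant \<open>- 384 z^3\<close>.\<close>

lemma claw_gamma_recurrence:
  "poly (claw_gamma (n + 3)) t = 20 * t * poly (claw_gamma (n + 2)) t
     + 8 * t * (3 - 8 * t) * poly (claw_gamma (n + 1)) t - 384 * t ^ 3 * poly (claw_gamma n) t"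
  by (simp add: claw_gamma_def numeral_3_eq_3 numeral_2_eq_2 algebra_simps)

text \<open>\<open>claw_U k\<close> is \<open>W\<close> with index \<open>k - 1\<close>; the value \<open>1/4\<close> extends the recurrence to \<open>W\<close> with index \<open>-1\<close>.\<close>

fun claw_U :: "nat \<Rightarrow> real poly" where
  "claw_U 0 = [:1 / 4:]"
| "claw_U (Suc 0) = [:2, 2:]"
| "claw_U (Suc (Suc 0)) = [:40, 24:]"
| "claw_U (Suc (Suc (Suc k))) = (if even k
     then [:0, 20:] * claw_U (Suc (Suc k)) + [:24, -64:] * claw_U (Suc k) - [:0, 0, 384:] * claw_U k
     else [:20:] * claw_U (Suc (Suc k)) + [:24, -64:] * claw_U (Suc k) - [:0, 384:] * claw_U k)"

lemma poly_claw_U_even: "even k \<Longrightarrow> poly (claw_U (k + 3)) t =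
    20 * t * poly (claw_U (k + 2)) t + 8 * (3 - 8 * t) * poly (claw_U (k + 1)) t - 384 * t\<^sup>2 * poly (claw_U k) t"
  by (simp add: eval_nat_numeral algebra_simps)

lemma poly_claw_U_odd: "odd k \<Longrightarrow> poly (claw_U (k + 3)) t =
    20 * poly (claw_U (k + 2)) t + 8 * (3 - 8 * t) * poly (claw_U (k + 1)) t - 384 * t * poly (claw_U k) t"
  by (simp add: eval_nat_numeral algebra_simps)

lemma claw_U_0_pos: "poly (claw_U k) 0 > 0"
  by (induction k rule: claw_U.induct) auto

lemma poly_claw_gamma: "poly (claw_gamma n) t = t ^ ((n + 1) div 2) * poly (claw_U (n + 1)) t"
proof (induction n rule: less_induct)
  case (less n)
  consider "n = 0" | "n = 1" | "n = 2" | m where "n = m + 3"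
    by (metis One_nat_def Suc_1 add.commute add_2_eq_Suc' less_2_cases_iff less_SucE not_less
        numeral_3_eq_3 le_Suc_ex)
  then show ?case
  proof cases
    case 1
    then show ?thesis by (simp add: claw_gamma_def)
  next
    case 2
    then show ?thesis by (simp add: claw_gamma_def algebra_simps)
  next
    case 3
    \<comment> \<open>Computed directly, since the recurrence for \<open>claw_U 3\<close> uses
      \<open>claw_U 0\<close>, to which no graph corresponds. The quadratic coefficient
      \<open>352 - 384 / 4 = 256\<close> is what fixes the constant \<open>1 / 4\<close>.\<close>
    have "poly (claw_gamma 2) t = 48 * t + 720 * t\<^sup>2 + 256 * t ^ 3"
      "poly (claw_U 3) t = 48 + 720 * t + 256 * t\<^sup>2"
      by (simp_all add: claw_gamma_def eval_nat_numeral algebra_simps)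
    then show ?thesis using 3 by (simp add: algebra_simps power2_eq_square power3_eq_cube)
  next
    case (4 m)
    have IH: "poly (claw_gamma m) t = t ^ ((m + 1) div 2) * poly (claw_U (m + 1)) t"
      "poly (claw_gamma (m + 1)) t = t ^ ((m + 2) div 2) * poly (claw_U (m + 2)) t"
      "poly (claw_gamma (m + 2)) t = t ^ ((m + 3) div 2) * poly (claw_U (m + 3)) t"
      using less[of m] less[of "m + 1"] less[of "m + 2"] 4 by (simp_all add: numeral_2_eq_2 numeral_3_eq_3)
    have num: "m + 1 + 1 = m + 2" "m + 1 + 2 = m + 3" "n + 1 = m + 1 + 3" using 4 by simp_all
    show ?thesis
    proof (cases "even m")
      case True
      then obtain l where l: "m = 2 * l" by (elim evenE)
      have "odd (m + 1)" using True by simp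
      note U = poly_claw_U_odd[OF this, of t, unfolded num(1,2)]
      have e: "(m + 1) div 2 = l" "(m + 2) div 2 = l + 1" "(m + 3) div 2 = l + 1" "(m + 1 + 3) div 2 = l + 2"
        using l by auto
      show ?thesis
        unfolding 4 claw_gamma_recurrence IH unfolding num(3)[unfolded 4] e U
        by (simp add: algebra_simps power2_eq_square power3_eq_cube)
    next
      case False
      then obtain l where l: "m = 2 * l + 1" by (elim oddE)
      have "even (m + 1)" using False by simp
      note U = poly_claw_U_even[OF this, of t, unfolded num(1,2)]
      have e: "(m + 1) div 2 = l + 1" "(m + 2) div 2 = l + 1" "(m + 3) div 2 = l + 2" "(m + 1 + 3) div 2 = l + 2"
        using l by auto
      show ?thesis
        unfolding 4 claw_gamma_recurrence IH unfolding num(3)[unfolded 4] e U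
        by (simp add: algebra_simps power2_eq_square power3_eq_cube)
    qed
  qed
qed

lemma claw_gamma_eq: "claw_gamma n = monom 1 ((n + 1) div 2) * claw_U (n + 1)"
  by (rule poly_eq_poly_eq_iff[THEN iffD1]) (simp add: fun_eq_iff poly_claw_gamma poly_monom)

lemma claw_W_eq: "claw_W n = claw_U (n + 1)"
proof -
  have "monom (1 :: real) ((n + 1) div 2) \<noteq> 0" by simp
  then show ?thesis
    unfolding claw_W_def claw_genus_poly_eq claw_gamma_eq by (rule nonzero_mult_div_cancel_left)
qed

text \<open>Read off from the genus polynomials: in the recurrence the leading terms enter with
  opposite signs and might cancel.\<close>

lemma claw_U_degree: "degree (claw_U k) = (k + 1) div 2" and claw_U_lead: "lead_coeff (claw_U k) > 0"
proof -
  have "degree (claw_U k) = (k + 1) div 2 \<and> lead_coeff (claw_U k) > 0"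
  proof (cases k)
    case (Suc n)
    have "claw_U (n + 1) \<noteq> 0" using claw_gamma_degree(2)[of n] unfolding claw_gamma_eq by auto
    then have "(n + 1) div 2 + degree (claw_U (n + 1)) = n + 1"
      using claw_gamma_degree(1)[of n] unfolding claw_gamma_eq
      by (subst (asm) degree_mult_eq) (simp_all add: degree_monom_eq)
    moreover have "lead_coeff (claw_U (n + 1)) > 0"
      using claw_gamma_degree(2)[of n] unfolding claw_gamma_eq lead_coeff_mult
      by (simp add: degree_monom_eq)
    ultimately show ?thesis using Suc by simp
  qed simp
  then show "degree (claw_U k) = (k + 1) div 2" "lead_coeff (claw_U k) > 0" by blast+
qed

interpretation claw_U: claw_recurrence claw_U
  by unfold_locales
    ((rule claw_U_degree claw_U_lead claw_U_0_pos poly_claw_U_even poly_claw_U_odd; assumption?)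
      | simp add: numeral_2_eq_2)+

text \<open>The \<open>degree p\<close> real zeros already exhaust what the complex polynomial can
  have.\<close>

lemma real_rooted_descending:
  assumes p: "descending_roots p x" shows "real_rooted p"
proof -
  let ?P = "map_poly complex_of_real p"
  have p0: "p \<noteq> 0" using p by (auto simp: descending_roots_def)
  have deg: "degree ?P = degree p" by (rule degree_map_poly) simp
  have P0: "?P \<noteq> 0" using p0 by (simp add: map_poly_eq_0_iff)
  have eval: "poly ?P (complex_of_real t) = complex_of_real (poly p t)" for t
    by (induction p) (simp_all add: map_poly_pCons)
  have "complex_of_real ` {t. poly p t = 0} \<subseteq> {z. poly ?P z = 0}" by (auto simp: eval)
  moreover have "card (complex_of_real ` {t. poly p t = 0}) = degree p"
    using descending_roots_set(2)[OF p] by (simp add: card_image inj_on_def)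
  ultimately have "complex_of_real ` {t. poly p t = 0} = {z. poly ?P z = 0}"
    using card_seteq[OF poly_roots_finite[OF P0]] card_poly_roots_bound[OF P0] deg by simp
  then have "z \<in> \<real>" if "poly ?P z = 0" for z
    using that imageE[of z complex_of_real] by (metis mem_Collect_eq Reals_of_real)
  then show ?thesis using p0 unfolding real_rooted_def by blast
qed

lemma claw_W_descending: "descending_roots (claw_W n) (nth_root (claw_W n))"
  using claw_U.consecutive_descending[OF claw_U.interlacing[THEN conjunct1]] by (simp add: claw_W_eq)

section \<open>Translation to roots counted from the smallest\<close>

lemma claw_deg_eq: "claw_deg n = (n + 2) div 2"
proof (cases "even n")
  case True
  then obtain m where n: "n = 2 * m" by (elim evenE)
  have "\<lceil>(real n + 1) / 2\<rceil> = int m + 1" unfolding n by (rule ceiling_unique) auto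
  then show ?thesis unfolding claw_deg_def n by simp
next
  case False
  then obtain m where n: "n = 2 * m + 1" by (elim oddE)
  have "(real n + 1) / 2 = of_int (int m + 1)" unfolding n by simp
  then have "\<lceil>(real n + 1) / 2\<rceil> = int m + 1" by (simp only: ceiling_of_int)
  then show ?thesis unfolding claw_deg_def n by simp
qed

lemma degree_claw_W: "degree (claw_W n) = claw_deg n"
  by (simp add: claw_W_eq claw_U_degree claw_deg_eq)

lemma card_real_roots_claw_W: "card (real_roots (claw_W n)) = claw_deg n"
  using descending_roots_set(2)[OF claw_W_descending] by (simp add: real_roots_def degree_claw_W)

text \<open>\<open>claw_root\<close> counts upwards from 1, \<open>nth_root\<close> downwards from
  0, so the two indices add up to the degree.\<close>

lemma claw_root_eq:
  assumes "i \<in> {1..claw_deg n}" shows "claw_root n i = nth_root (claw_W n) (claw_deg n - i)"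
proof -
  have "claw_deg n - 1 - (claw_deg n - i) = i - 1" using assms by auto
  then show ?thesis unfolding claw_root_def nth_root_def degree_claw_W by simp
qed

lemma claw_roots_interlace_Suc:
  assumes "interlaces (claw_W n) (claw_W m)" "claw_deg n = Suc (claw_deg m)" "i \<in> {1..<claw_deg n}"
  shows "claw_root n i < claw_root m i \<and> claw_root m i < claw_root n (i + 1)"
proof -
  let ?j = "claw_deg m - i"
  have lt: "nth_root (claw_W n) (Suc ?j) < nth_root (claw_W m) ?j" "nth_root (claw_W m) ?j < nth_root (claw_W n) ?j"
    using assms unfolding interlaces_def degree_claw_W by auto
  have "claw_root n i = nth_root (claw_W n) (Suc ?j)"
    using claw_root_eq[of i n] assms(2,3) by (simp add: Suc_diff_le)
  moreover have "claw_root m i = nth_root (claw_W m) ?j"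
    using claw_root_eq[of i m] assms(2,3) by simp
  moreover have "claw_root n (i + 1) = nth_root (claw_W n) ?j"
    using claw_root_eq[of "i + 1" n] assms(2,3) by simp
  ultimately show ?thesis using lt by simp
qed

lemma claw_roots_interlace_eq:
  assumes "interlaces (claw_W m) (claw_W n)" "claw_deg n = claw_deg m"
  shows "i \<in> {1..claw_deg n} \<Longrightarrow> claw_root n i < claw_root m i"
    and "i \<in> {1..<claw_deg n} \<Longrightarrow> claw_root m i < claw_root n (i + 1)"
proof -
  assume i: "i \<in> {1..claw_deg n}"
  then show "claw_root n i < claw_root m i"
    using assms claw_root_eq[of i n] claw_root_eq[of i m] unfolding interlaces_def degree_claw_W by simp
next
  assume i: "i \<in> {1..<claw_deg n}"
  then have "Suc (claw_deg n - (i + 1)) = claw_deg m - i" "Suc (claw_deg n - (i + 1)) < claw_deg m"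
    using assms(2) by auto
  then have "nth_root (claw_W m) (claw_deg m - i) < nth_root (claw_W n) (claw_deg n - (i + 1))"
    using assms(1) unfolding interlaces_def degree_claw_W by metis
  then show "claw_root m i < claw_root n (i + 1)"
    using i assms(2) claw_root_eq[of "i + 1" n] claw_root_eq[of i m] by simp
qed

theorem theorem4p2:
  shows "(\<forall>n. monom 1 ((n + 1) div 2) * claw_W n = claw_genus_poly n \<and>
              degree (claw_W n) = claw_deg n \<and>
              real_rooted (claw_W n) \<and>
              card (real_roots (claw_W n)) = claw_deg n) \<and>
         (\<forall>n\<ge>2. card (real_roots (claw_W n)) = card (real_roots (claw_W (n - 2))) + 1 \<and>
                (\<forall>i\<in>{1..<claw_deg n}. claw_root n i < claw_root (n - 2) i \<and> claw_root (n - 2) i < claw_root n (i + 1))) \<and>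
         (\<forall>n\<ge>1. even n \<longrightarrow>
                card (real_roots (claw_W n)) = card (real_roots (claw_W (n - 1))) + 1 \<and>
                (\<forall>i\<in>{1..<claw_deg n}. claw_root n i < claw_root (n - 1) i \<and> claw_root (n - 1) i < claw_root n (i + 1))) \<and>
         (\<forall>n\<ge>1. odd n \<longrightarrow>
                card (real_roots (claw_W n)) = card (real_roots (claw_W (n - 1))) \<and>
                (\<forall>i\<in>{1..claw_deg n}. claw_root n i < claw_root (n - 1) i) \<and>
                (\<forall>i\<in>{1..<claw_deg n}. claw_root (n - 1) i < claw_root n (i + 1)))"
proof (intro conjI allI impI)
  fix n
  show "monom 1 ((n + 1) div 2) * claw_W n = claw_genus_poly n"
    unfolding claw_W_eq claw_genus_poly_eq claw_gamma_eq ..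
  show "degree (claw_W n) = claw_deg n" by (rule degree_claw_W)
  show "real_rooted (claw_W n)" by (rule real_rooted_descending[OF claw_W_descending])
  show "card (real_roots (claw_W n)) = claw_deg n" by (rule card_real_roots_claw_W)
next
  fix n :: nat assume n: "n \<ge> 2"
  then obtain k where k: "n = k + 2" by (metis add.commute le_Suc_ex)
  have il: "interlaces (claw_W n) (claw_W (n - 2))"
    using claw_U.interlacing[of "k + 1"] unfolding k claw_W_eq by (simp add: numeral_2_eq_2)
  have deg: "claw_deg n = Suc (claw_deg (n - 2))" unfolding k claw_deg_eq by simp
  show "card (real_roots (claw_W n)) = card (real_roots (claw_W (n - 2))) + 1"
    unfolding card_real_roots_claw_W using deg by simp
  show "\<forall>i\<in>{1..<claw_deg n}. claw_root n i < claw_root (n - 2) i \<and> claw_root (n - 2) i < claw_root n (i + 1)"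
    using claw_roots_interlace_Suc[OF il deg] by blast
next
  fix n :: nat assume n: "n \<ge> 1" "even n"
  \<comment> \<open>\<open>claw_W n\<close> is \<open>claw_U (n + 1)\<close>, so the lower index of
    this pair is \<open>n\<close>, whose parity decides which polynomial has the largest
    root.\<close>
  have il: "interlaces (claw_W n) (claw_W (n - 1))"
    using claw_U.interlacing[of n] n unfolding claw_U.consecutive_def claw_W_eq by simp
  have deg: "claw_deg n = Suc (claw_deg (n - 1))" using n unfolding claw_deg_eq by (auto elim!: evenE)
  show "card (real_roots (claw_W n)) = card (real_roots (claw_W (n - 1))) + 1"
    unfolding card_real_roots_claw_W using deg by simp
  show "\<forall>i\<in>{1..<claw_deg n}. claw_root n i < claw_root (n - 1) i \<and> claw_root (n - 1) i < claw_root n (i + 1)"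
    using claw_roots_interlace_Suc[OF il deg] by blast
next
  fix n :: nat assume n: "n \<ge> 1" "odd n"
  have il: "interlaces (claw_W (n - 1)) (claw_W n)"
    using claw_U.interlacing[of n] n unfolding claw_U.consecutive_def claw_W_eq by simp
  have deg: "claw_deg n = claw_deg (n - 1)" using n unfolding claw_deg_eq by (auto elim!: oddE)
  show "card (real_roots (claw_W n)) = card (real_roots (claw_W (n - 1)))"
    unfolding card_real_roots_claw_W using deg by simp
  show "\<forall>i\<in>{1..claw_deg n}. claw_root n i < claw_root (n - 1) i"
    using claw_roots_interlace_eq(1)[OF il deg] by blast
  show "\<forall>i\<in>{1..<claw_deg n}. claw_root (n - 1) i < claw_root n (i + 1)"
    using claw_roots_interlace_eq(2)[OF il deg] by blast
qed

end
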